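(* Let $R>0$, $q\in\mathbb N$ and $\Lambda>0$. There exists a constant $C=C(R,\Lambda,q)>0$, depending only on $R,\Lambda,q$, such that for every $(\lambda,\mathbf u)\in\mathcal Z_{\rm reg}$ with $0<\lambda\le\Lambda$ and vertical nodal number $q$, setting $\mathbf x:=\mathbf x_0+\mathbf u$, one has $$\|\mathbf x\|_{W^{2,\infty}(\mathbb T,\mathbb R^3)}\le C.$$ In particular, $\|\mathbf u\|_{H^2(\mathbb T,\mathbb R^3)}\le C$ (with a constant depending only on $R,\Lambda,q$).
   Context: Fix $R>0$; $\mathbb T=\mathbb R/2\pi\mathbb Z$, $e_3=(0,0,1)$, $\mathbf x_0(\eta)=(R\cos\eta,R\sin\eta,0)$. Zero set. $\mathcal Z$ is the set of $(\lambda,\mathbf u)\in(0,+\infty)\times H^2(\mathbb T,\mathbb R^3)$ such that $\mathbf x=\mathbf x_0+\mathbf u$ is a ($2\pi$-periodic) solution of $\mathbf x\times\mathbf x''-\lambda e_3\times\mathbf x+\lambda\mathbf x'=0$ with $\|\mathbf x\|\equiv R$. Vertical polynomial. For $(\lambda,\mathbf u)\in\mathcal Z$, $\mathbf x=\mathbf x_0+\mathbf u$, the quantities $C_{\mathbf x}=(\mathbf x\times\mathbf x')_3+\lambda x_3$ and $E=\frac\lambda2\|\mathbf x'\|^2+\lambda(x_2x_1'-x_1x_2')$ are constant in $\eta$, and $u=x_3$ satisfies $(u')^2=P(u)$ where $P(s)=a_3s^3-a_2s^2+a_1s+a_0$ with $a_0=\frac{2ER^2-\lambda C_{\mathbf x}^2+2\lambda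 C_{\mathbf x}R^2}{\lambda R^2}$, $a_1=\frac{2\lambda C_{\mathbf x}-2\lambda R^2}{R^2}$, $a_2=\frac{2E+\lambda^3+2\lambda C_{\mathbf x}}{\lambda R^2}$, $a_3=\frac{2\lambda}{R^2}$. Regular class. $\mathcal Z_{\rm reg}\subset\mathcal Z$ is the set of $(\lambda,\mathbf u)$ such that, with $u=x_3$: (1) $-R<u(\eta)<R$ for all $\eta$; (2) $u$ is not constant; (3) with $e_1=\min_{\mathbb T}u$, $e_2=\max_{\mathbb T}u$, the polynomial $P$ has a third real root, the number $e_3$, with $-R<e_1<e_2<R$, $e_2<e_3$, and $P(s)=\frac{2\lambda}{R^2}(s-e_1)(s-e_2)(s-e_3)$. Vertical nodal number. For $(\lambda,\mathbf u)\in\mathcal Z_{\rm reg}$ the vertical nodal number $q\in\mathbb N$ is the number of full oscillations of $x_3$ on $[0,2\pi]$, i.e. the minimal period of $x_3$ is $2\pi/q$. *)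

theory Defs
  imports "HOL-Analysis.Analysis" "HOL-Probability.Essential_Supremum"
begin

text \<open>
  Functions on the circle \<open>\<real>/2\<pi>\<int>\<close> are \<open>2\<pi>\<close>-periodic functions on the real line; the measure on
  the circle is Lebesgue measure on one period.
\<close>

definition periodic_2pi :: "(real \<Rightarrow> 'a) \<Rightarrow> bool" where
  "periodic_2pi f \<longleftrightarrow> (\<forall>t. f (t + 2 * pi) = f t)"

abbreviation circle :: "real measure" where
  "circle \<equiv> lebesgue_on {0..2 * pi}"

text \<open>Because the test functions are periodic, the integration by parts below has no boundary
  terms and \<open>g\<close> is the weak derivative of \<open>f\<close> on the circle, not merely on the open
  interval.\<close>

definition has_weak_derivative ::
    "(real \<Rightarrow> 'a::euclidean_space) \<Rightarrow> (real \<Rightarrow> 'a) \<Rightarrow> bool" where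
  "has_weak_derivative f g \<longleftrightarrow>
     integrable circle f \<and> integrable circle g \<and>
     (\<forall>\<phi> \<phi>' :: real \<Rightarrow> real.
        periodic_2pi \<phi> \<longrightarrow>
        (\<forall>t. (\<phi> has_real_derivative \<phi>' t) (at t)) \<longrightarrow> continuous_on UNIV \<phi>' \<longrightarrow>
        (\<integral>t. \<phi>' t *\<^sub>R f t \<partial>circle) = - (\<integral>t. \<phi> t *\<^sub>R g t \<partial>circle))"

text \<open>The weak derivative is determined only up to null sets of the circle, so \<open>wderiv\<close> must only
  be used in statements that hold almost everywhere or under integrals and essential suprema.\<close>

definition wderiv :: "(real \<Rightarrow> 'a::euclidean_space) \<Rightarrow> real \<Rightarrow> 'a" where
  "wderiv f = (SOME g. has_weak_derivative f g)"

definition L2_circle :: "(real \<Rightarrow> 'a::euclidean_space) set" where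
  "L2_circle = {f \<in> borel_measurable circle. integrable circle (\<lambda>t. (norm (f t))\<^sup>2)}"

text \<open>\<open>H\<^sup>2\<close> on the circle; its elements are identified with their continuous representatives.\<close>

definition H2_circle :: "(real \<Rightarrow> 'a::euclidean_space) set" where
  "H2_circle = {u. periodic_2pi u \<and> continuous_on UNIV u \<and>
     (\<exists>v w. v \<in> L2_circle \<and> w \<in> L2_circle \<and> has_weak_derivative u v \<and> has_weak_derivative v w)}"

definition H2_norm :: "(real \<Rightarrow> 'a::euclidean_space) \<Rightarrow> real" where
  "H2_norm u = sqrt (\<integral>t. (norm (u t))\<^sup>2 + (norm (wderiv u t))\<^sup>2 + (norm (wderiv (wderiv u) t))\<^sup>2 \<partial>circle)"

definition Linf_norm :: "(real \<Rightarrow> 'a::euclidean_space) \<Rightarrow> ereal" where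
  "Linf_norm f = esssup circle (\<lambda>t. ereal (norm (f t)))"

definition W2inf_norm :: "(real \<Rightarrow> 'a::euclidean_space) \<Rightarrow> ereal" where
  "W2inf_norm x = Linf_norm x + Linf_norm (wderiv x) + Linf_norm (wderiv (wderiv x))"

definition x0 :: "real \<Rightarrow> real \<Rightarrow> real^3" where
  "x0 R \<eta> = vector [R * cos \<eta>, R * sin \<eta>, 0]"

definition curve :: "real \<Rightarrow> (real \<Rightarrow> real^3) \<Rightarrow> real \<Rightarrow> real^3" where
  "curve R u = (\<lambda>\<eta>. x0 R \<eta> + u \<eta>)"

definition is_solution :: "real \<Rightarrow> (real \<Rightarrow> real^3) \<Rightarrow> bool" where
  "is_solution lam x \<longleftrightarrow>
     (AE \<eta> in circle. cross3 (x \<eta>) (wderiv (wderiv x) \<eta>)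
        - lam *\<^sub>R cross3 (axis 3 1) (x \<eta>) + lam *\<^sub>R wderiv x \<eta> = 0)"

definition Zset :: "real \<Rightarrow> (real \<times> (real \<Rightarrow> real^3)) set" where
  "Zset R = {(lam, u). 0 < lam \<and> u \<in> H2_circle \<and>
      is_solution lam (curve R u) \<and> (\<forall>\<eta>. norm (curve R u \<eta>) = R)}"

text \<open>A curve of class \<open>H\<^sup>2\<close> is continuously differentiable, so the pointwise values of its first
  derivative are the classical ones. Both quantities below are constant in \<open>\<eta>\<close> along the curves
  of \<open>Zset R\<close>; their constant values are read off at \<open>\<eta> = 0\<close>.\<close>

definition C_fun :: "real \<Rightarrow> (real \<Rightarrow> real^3) \<Rightarrow> real \<Rightarrow> real" where
  "C_fun lam x \<eta> = cross3 (x \<eta>) (vector_derivative x (at \<eta>)) $ 3 + lam * (x \<eta> $ 3)"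

definition E_fun :: "real \<Rightarrow> (real \<Rightarrow> real^3) \<Rightarrow> real \<Rightarrow> real" where
  "E_fun lam x \<eta> = (let x' = vector_derivative x (at \<eta>) in
     lam / 2 * (norm x')\<^sup>2 + lam * (x \<eta> $ 2 * x' $ 1 - x \<eta> $ 1 * x' $ 2))"

definition C_const :: "real \<Rightarrow> (real \<Rightarrow> real^3) \<Rightarrow> real" where
  "C_const lam x = C_fun lam x 0"

definition E_const :: "real \<Rightarrow> (real \<Rightarrow> real^3) \<Rightarrow> real" where
  "E_const lam x = E_fun lam x 0"

definition vertical_poly :: "real \<Rightarrow> real \<Rightarrow> (real \<Rightarrow> real^3) \<Rightarrow> real \<Rightarrow> real" where
  "vertical_poly R lam x s =
    (let C = C_const lam x; E = E_const lam x;
         a0 = (2 * E * R\<^sup>2 - lam * C\<^sup>2 + 2 * lam * C * R\<^sup>2) / (lam * R\<^sup>2);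
         a1 = (2 * lam * C - 2 * lam * R\<^sup>2) / R\<^sup>2;
         a2 = (2 * E + lam ^ 3 + 2 * lam * C) / (lam * R\<^sup>2);
         a3 = 2 * lam / R\<^sup>2
     in a3 * s ^ 3 - a2 * s\<^sup>2 + a1 * s + a0)"

definition is_min_value :: "(real \<Rightarrow> real) \<Rightarrow> real \<Rightarrow> bool" where
  "is_min_value f m \<longleftrightarrow> m \<in> range f \<and> (\<forall>y\<in>range f. m \<le> y)"

definition is_max_value :: "(real \<Rightarrow> real) \<Rightarrow> real \<Rightarrow> bool" where
  "is_max_value f m \<longleftrightarrow> m \<in> range f \<and> (\<forall>y\<in>range f. y \<le> m)"

definition vertical :: "real \<Rightarrow> (real \<Rightarrow> real^3) \<Rightarrow> real \<Rightarrow> real" where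
  "vertical R u = (\<lambda>\<eta>. curve R u \<eta> $ 3)"

definition Zreg :: "real \<Rightarrow> (real \<times> (real \<Rightarrow> real^3)) set" where
  "Zreg R = {(lam, u). (lam, u) \<in> Zset R \<and>
     (\<forall>\<eta>. - R < vertical R u \<eta> \<and> vertical R u \<eta> < R) \<and>
     \<not> (\<exists>c. \<forall>\<eta>. vertical R u \<eta> = c) \<and>
     (\<exists>e1 e2 e3. is_min_value (vertical R u) e1 \<and> is_max_value (vertical R u) e2 \<and>
        - R < e1 \<and> e1 < e2 \<and> e2 < R \<and> e2 < e3 \<and>
        (\<forall>s. vertical_poly R lam (curve R u) s =
               2 * lam / R\<^sup>2 * (s - e1) * (s - e2) * (s - e3)))}"

definition minimal_period :: "(real \<Rightarrow> real) \<Rightarrow> real \<Rightarrow> bool" where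
  "minimal_period f T \<longleftrightarrow> 0 < T \<and> (\<forall>t. f (t + T) = f t) \<and>
     (\<forall>S. 0 < S \<and> S < T \<longrightarrow> \<not> (\<forall>t. f (t + S) = f t))"

definition vertical_nodal_number :: "real \<Rightarrow> (real \<Rightarrow> real^3) \<Rightarrow> nat \<Rightarrow> bool" where
  "vertical_nodal_number R u q \<longleftrightarrow> 0 < q \<and> minimal_period (vertical R u) (2 * pi / real q)"

end

theory Submission
  imports Defs
begin

text \<open>
  A weak solution is classical: the weak derivative of an \<open>H\<^sup>2\<close> curve has a continuous
  representative, and the equation together with \<open>\<bar>x\<bar> = R\<close> expresses \<open>x''\<close> as a polynomial in \<open>x\<close>
  and \<open>x'\<close>. It therefore suffices to bound the speed.

  Comparing the coefficient of \<open>s\<^sup>2\<close> in the vertical polynomial with its roots gives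
  \<open>\<bar>x'\<bar>\<^sup>2 = 2 \<lambda> (e\<^sub>1 + e\<^sub>2 + e\<^sub>3 - x\<^sub>3) - \<lambda>\<^sup>2\<close>, so only \<open>\<lambda> e\<^sub>3\<close> has to be controlled. In
  the coordinate \<open>\<theta> = arcsin ((2 x\<^sub>3 - e\<^sub>1 - e\<^sub>2) / (e\<^sub>2 - e\<^sub>1))\<close> a rising arc from \<open>e\<^sub>1\<close> to \<open>e\<^sub>2\<close>
  has length \<open>\<pi>\<close> and is traversed at speed \<open>\<theta>' = \<surd>(2 \<lambda> (e\<^sub>3 - x\<^sub>3)) / R\<close>. Reflecting in the
  two end points of the arc shows that twice its duration is a period of \<open>x\<^sub>3\<close>, hence
  \<open>2 \<pi> / q \<le> 2 \<pi> R / \<surd>(2 \<lambda> (e\<^sub>3 - e\<^sub>2))\<close>, that is, \<open>2 \<lambda> (e\<^sub>3 - e\<^sub>2) \<le> q\<^sup>2 R\<^sup>2\<close>.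
\<close>

section \<open>Weak derivatives on the circle\<close>

definition C1_periodic :: "(real \<Rightarrow> real) \<Rightarrow> (real \<Rightarrow> real) \<Rightarrow> bool" where
  "C1_periodic \<phi> \<phi>' \<longleftrightarrow> periodic_2pi \<phi> \<and> (\<forall>t. (\<phi> has_real_derivative \<phi>' t) (at t)) \<and>
     continuous_on UNIV \<phi>'"

lemma C1_periodicI:
  assumes "periodic_2pi \<phi>" "\<And>t. (\<phi> has_real_derivative \<phi>' t) (at t)" "continuous_on UNIV \<phi>'"
  shows "C1_periodic \<phi> \<phi>'"
  using assms by (simp add: C1_periodic_def)

lemma C1_periodicD:
  assumes "C1_periodic \<phi> \<phi>'"
  shows "periodic_2pi \<phi>" "\<And>t. (\<phi> has_real_derivative \<phi>' t) (at t)" "continuous_on UNIV \<phi>'"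
    "continuous_on UNIV \<phi>"
  using assms
  by (auto simp: C1_periodic_def continuous_on_eq_continuous_at intro: DERIV_isCont)

lemma has_weak_derivative_altdef:
  "has_weak_derivative f g \<longleftrightarrow> integrable circle f \<and> integrable circle g \<and>
     (\<forall>\<phi> \<phi>'. C1_periodic \<phi> \<phi>' \<longrightarrow>
        (\<integral>t. \<phi>' t *\<^sub>R f t \<partial>circle) = - (\<integral>t. \<phi> t *\<^sub>R g t \<partial>circle))"
  unfolding has_weak_derivative_def C1_periodic_def by blast

lemma has_weak_derivativeD:
  assumes "has_weak_derivative f g"
  shows "integrable circle f" "integrable circle g"
    "\<And>\<phi> \<phi>'. C1_periodic \<phi> \<phi>' \<Longrightarrow>
        (\<integral>t. \<phi>' t *\<^sub>R f t \<partial>circle) = - (\<integral>t. \<phi> t *\<^sub>R g t \<partial>circle)"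
  using assms unfolding has_weak_derivative_altdef by blast+

section \<open>The fundamental lemma of the calculus of variations on the circle\<close>

lemma sigma_finite_circle: "sigma_finite_measure circle"
  by (intro finite_measure.axioms finite_measure_lebesgue_on) auto

lemma integrable_circle_continuous:
  fixes f :: "real \<Rightarrow> 'a::euclidean_space"
  assumes "continuous_on {0..2 * pi} f"
  shows "integrable circle f"
  using continuous_imp_integrable_real[OF assms] .

lemma integrable_circle_mult:
  fixes g :: "real \<Rightarrow> 'a::euclidean_space"
  assumes \<phi>: "continuous_on UNIV \<phi>" and g: "integrable circle g"
  shows "integrable circle (\<lambda>t. \<phi> t *\<^sub>R g t)"
proof -
  have \<phi>': "continuous_on {0..2 * pi} \<phi>"
    using \<phi> continuous_on_subset by blast
  then have "compact (\<phi> ` {0..2 * pi})"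
    by (intro compact_continuous_image) auto
  then obtain B where B: "\<And>t. t \<in> {0..2 * pi} \<Longrightarrow> norm (\<phi> t) \<le> B"
    by (metis bounded_iff compact_imp_bounded imageI)
  have [measurable]: "\<phi> \<in> borel_measurable circle" "g \<in> borel_measurable circle"
    using integrable_circle_continuous[OF \<phi>'] g by auto
  show ?thesis
  proof (rule Bochner_Integration.integrable_bound[where f = "\<lambda>t. B * norm (g t)"])
    show "integrable circle (\<lambda>t. B * norm (g t))" using g by auto
    show "AE t in circle. norm (\<phi> t *\<^sub>R g t) \<le> norm (B * norm (g t))"
    proof (rule AE_I2)
      fix t assume "t \<in> space circle"
      then have "norm (\<phi> t) \<le> B" using B by simp
      then show "norm (\<phi> t *\<^sub>R g t) \<le> norm (B * norm (g t))"
        by (simp add: mult_right_mono abs_mult)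
    qed
  qed measurable
qed

text \<open>The bump function is built from \<open>2 sin ((t - a) / 2) sin ((b - t) / 2)
  = cos (t - (a + b) / 2) - cos ((b - a) / 2)\<close>, which is periodic and, on one period, positive
  exactly on the given interval.\<close>

lemma cos_bump_pos_iff:
  assumes "0 \<le> a" "a \<le> b" "b \<le> 2 * pi" "0 \<le> t" "t \<le> 2 * pi"
  shows "cos (t - (a + b) / 2) - cos ((b - a) / 2) > 0 \<longleftrightarrow> a < t \<and> t < b"
proof -
  have eq: "cos (t - (a + b) / 2) - cos ((b - a) / 2) = 2 * sin ((t - a) / 2) * sin ((b - t) / 2)"
  proof -
    have "(t - (a + b) / 2 + (b - a) / 2) / 2 = (t - a) / 2"
      "((b - a) / 2 - (t - (a + b) / 2)) / 2 = (b - t) / 2"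
      by (simp_all add: field_simps)
    then show ?thesis using cos_diff_cos[of "t - (a + b) / 2" "(b - a) / 2"] by metis
  qed
  have sgn_sin: "sin (y / 2) > 0" if "0 < y" "y < 2 * pi" for y
    using that by (intro sin_gt_zero) auto
  have sgn_sin': "sin (y / 2) \<ge> 0" if "0 \<le> y" "y \<le> 2 * pi" for y
    using that by (intro sin_ge_zero) auto
  have sgn_neg: "sin (y / 2) \<le> 0" if "y \<le> 0" "- (2 * pi) \<le> y" for y
    using sgn_sin'[of "- y"] that by simp
  show ?thesis
  proof (cases "a < t \<and> t < b")
    case True
    then have "sin ((t - a) / 2) > 0" "sin ((b - t) / 2) > 0"
      using assms by (auto intro!: sgn_sin)
    then show ?thesis using True eq by simp
  next
    case False
    then consider "t \<le> a" | "b \<le> t" by linarith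
    then have "sin ((t - a) / 2) * sin ((b - t) / 2) \<le> 0"
    proof cases
      case 1
      then show ?thesis using assms
        by (intro mult_nonpos_nonneg sgn_neg sgn_sin') auto
    next
      case 2
      then show ?thesis using assms
        by (intro mult_nonneg_nonpos sgn_neg sgn_sin') auto
    qed
    then show ?thesis using False unfolding eq
      by (metis mult.assoc mult_le_cancel_left_pos mult_zero_right not_le zero_less_numeral)
  qed
qed

text \<open>Squaring removes the kink of the positive part, so the positive part of the cosine bump
  becomes a continuously differentiable test function.\<close>

lemma DERIV_max_0_power2:
  "((\<lambda>y::real. (max 0 y)\<^sup>2) has_real_derivative 2 * max 0 y) (at y)"
proof -
  consider "y > 0" | "y < 0" | "y = 0" by linarith
  then show ?thesis
  proof cases
    case 1
    have "((\<lambda>y::real. y\<^sup>2) has_real_derivative 2 * max 0 y) (at y)"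
      using 1 by (auto intro!: derivative_eq_intros)
    then show ?thesis
      by (rule has_field_derivative_transform_within[OF _ 1])
         (use 1 in \<open>auto simp: dist_real_def max_def\<close>)
  next
    case 2
    have "((\<lambda>y::real. 0) has_real_derivative 2 * max 0 y) (at y)"
      using 2 by (auto intro!: derivative_eq_intros)
    then show ?thesis
      by (rule has_field_derivative_transform_within[where d = "- y"])
         (use 2 in \<open>auto simp: dist_real_def max_def\<close>)
  next
    case 3
    have "((\<lambda>h::real. (max 0 h)\<^sup>2 / h) \<longlongrightarrow> 0) (at 0)"
    proof (rule Lim_null_comparison)
      show "\<forall>\<^sub>F h::real in at 0. norm ((max 0 h)\<^sup>2 / h) \<le> \<bar>h\<bar>"
        by (rule always_eventually) (auto simp: max_def power2_eq_square)
      show "((\<lambda>h::real. \<bar>h\<bar>) \<longlongrightarrow> 0) (at 0)"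
        by (rule tendsto_eq_intros refl)+ auto
    qed
    then show ?thesis using 3 by (simp add: DERIV_def)
  qed
qed

lemma indicator_measurable_circle:
  "A \<in> sets lebesgue \<Longrightarrow> (indicator A :: real \<Rightarrow> real) \<in> borel_measurable circle"
  by (intro measurable_restrict_space1 borel_measurable_indicator)

text \<open>The indicator of the interval is a pointwise limit of test functions with values in
  [0, 1], so dominated convergence with majorant \<open>norm (g t)\<close> applies.\<close>

lemma integral_open_interval_eq_0:
  fixes g :: "real \<Rightarrow> 'a::euclidean_space"
  assumes g: "integrable circle g"
    and Z: "\<And>\<phi> \<phi>'. C1_periodic \<phi> \<phi>' \<Longrightarrow> (\<integral>t. \<phi> t *\<^sub>R g t \<partial>circle) = 0"
    and ab: "0 \<le> a" "a \<le> b" "b \<le> 2 * pi"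
  shows "(\<integral>t. indicator {a<..<b} t *\<^sub>R g t \<partial>circle) = 0"
proof -
  define h where "h t = cos (t - (a + b) / 2) - cos ((b - a) / 2)" for t
  define p where "p t = (max 0 (h t))\<^sup>2" for t
  define p' where "p' t = 2 * max 0 (h t) * (- sin (t - (a + b) / 2))" for t
  \<comment> \<open>Saturation of the bump: where \<open>p\<close> is positive the quotient tends to
    1, where \<open>p\<close> vanishes it is 0 for every \<open>n\<close>.\<close>
  define \<phi> where "\<phi> n t = real n * p t / (1 + real n * p t)" for n t
  define \<phi>' where "\<phi>' n t = real n * p' t / (1 + real n * p t)\<^sup>2" for n t
  have hp: "(h has_real_derivative - sin (t - (a + b) / 2)) (at t)" for t
    unfolding h_def by (auto intro!: derivative_eq_intros)
  have pp: "(p has_real_derivative p' t) (at t)" for t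
    unfolding p_def p'_def
    using DERIV_chain2[OF DERIV_max_0_power2 hp, of t] by simp
  have p0: "p t \<ge> 0" for t by (simp add: p_def)
  have nz: "1 + real n * p t > 0" for n t
    using p0[of t] by (simp add: add_pos_nonneg)
  have C: "C1_periodic (\<phi> n) (\<phi>' n)" for n
  proof (rule C1_periodicI)
    have "h (t + 2 * pi) = h t" for t
      using cos_periodic[of "t - (a + b) / 2"] by (simp add: h_def algebra_simps)
    then show "periodic_2pi (\<phi> n)"
      by (simp add: periodic_2pi_def \<phi>_def p_def)
    show "(\<phi> n has_real_derivative \<phi>' n t) (at t)" for t
      unfolding \<phi>_def \<phi>'_def
      using nz[of n t]
      by (auto intro!: derivative_eq_intros pp simp: power2_eq_square field_simps)
    have "continuous_on UNIV p" using pp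
      by (meson DERIV_continuous_on has_field_derivative_at_within)
    moreover have "continuous_on UNIV p'"
      unfolding p'_def h_def by (intro continuous_intros)
    ultimately show "continuous_on UNIV (\<phi>' n)"
      unfolding \<phi>'_def
      using nz[of n] by (intro continuous_intros) (auto simp: less_le)
  qed
  have lim: "(\<lambda>n. \<phi> n t) \<longlonglongrightarrow> indicator {a<..<b} t" if t: "t \<in> {0..2 * pi}" for t
  proof (cases "a < t \<and> t < b")
    case True
    then have "h t > 0" using cos_bump_pos_iff[OF ab, of t] t by (simp add: h_def)
    then have pos: "p t > 0" by (simp add: p_def)
    have "(\<lambda>n. \<phi> n t) \<longlonglongrightarrow> 1"
    proof -
      have "(\<lambda>n. 1 - inverse (1 + real n * p t)) \<longlonglongrightarrow> 1 - 0"
        by (intro tendsto_diff tendsto_const tendsto_inverse_0_at_top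
            filterlim_tendsto_add_at_top[OF tendsto_const]
            filterlim_at_top_mult_tendsto_pos[OF tendsto_const pos] filterlim_real_sequentially)
      moreover have "1 - inverse (1 + real n * p t) = \<phi> n t" for n
        using nz[of n t] by (simp add: \<phi>_def field_simps)
      ultimately show ?thesis by simp
    qed
    then show ?thesis using True by simp
  next
    case False
    then have "\<not> h t > 0"
      using cos_bump_pos_iff[OF ab, of t] t unfolding h_def by auto
    then have "p t = 0" by (simp add: p_def)
    then show ?thesis using False by (auto simp add: \<phi>_def)
  qed
  have le1: "\<bar>\<phi> n t\<bar> \<le> 1" for n t
    using nz[of n t] p0[of t] by (auto simp: \<phi>_def)
  have [measurable]: "g \<in> borel_measurable circle" using g by auto
  have "(\<lambda>n. \<integral>t. \<phi> n t *\<^sub>R g t \<partial>circle) \<longlonglongrightarrow> (\<integral>t. indicator {a<..<b} t *\<^sub>R g t \<partial>circle)"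
  proof (rule integral_dominated_convergence[where w = "\<lambda>t. norm (g t)"])
    have [measurable]: "(indicator {a<..<b} :: real \<Rightarrow> real) \<in> borel_measurable circle"
      by (intro indicator_measurable_circle) auto
    show "(\<lambda>t. indicat_real {a<..<b} t *\<^sub>R g t) \<in> borel_measurable circle"
      by measurable
    show "(\<lambda>t. \<phi> n t *\<^sub>R g t) \<in> borel_measurable circle" for n
      using integrable_circle_mult[OF C1_periodicD(4)[OF C] g] by auto
    show "integrable circle (\<lambda>t. norm (g t))" using g by auto
    show "AE t in circle. (\<lambda>n. \<phi> n t *\<^sub>R g t) \<longlonglongrightarrow> indicator {a<..<b} t *\<^sub>R g t"
      by (rule AE_I2) (auto intro!: tendsto_scaleR lim)
    show "AE t in circle. norm (\<phi> n t *\<^sub>R g t) \<le> norm (g t)" for n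
      using le1[of n] by (auto intro!: AE_I2 mult_left_le_one_le)
  qed
  then show ?thesis using Z[OF C] by (simp add: LIMSEQ_const_iff)
qed

lemma AE_circle_neq: "AE t in circle. t \<noteq> c"
proof -
  have "AE t in lebesgue. t \<noteq> c"
    by (simp add: AE_completion AE_lborel_singleton)
  then show ?thesis
    by (subst AE_restrict_space_iff) auto
qed

lemma integrable_indicator_mult:
  fixes g :: "real \<Rightarrow> 'a::euclidean_space"
  assumes "integrable circle g" "A \<in> sets lebesgue"
  shows "integrable circle (\<lambda>t. indicator A t *\<^sub>R g t)"
proof (rule Bochner_Integration.integrable_bound[where f = g])
  note [measurable] = indicator_measurable_circle[OF assms(2)] borel_measurable_integrable[OF assms(1)]
  show "(\<lambda>t. indicat_real A t *\<^sub>R g t) \<in> borel_measurable circle" by measurable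
qed (use assms in \<open>auto simp: indicator_def\<close>)

text \<open>The sets over which \<open>g\<close> integrates to 0 contain the intervals and are
  closed under complements and countable disjoint unions, hence include all Borel sets; Lebesgue
  sets differ from Borel sets by null sets. A function whose integral over every measurable set is 0
  vanishes almost everywhere.\<close>

lemma AE_eq_0_if_test_integrals_0:
  fixes g :: "real \<Rightarrow> 'a::euclidean_space"
  assumes g: "integrable circle g"
    and Z: "\<And>\<phi> \<phi>'. C1_periodic \<phi> \<phi>' \<Longrightarrow> (\<integral>t. \<phi> t *\<^sub>R g t \<partial>circle) = 0"
  shows "AE t in circle. g t = 0"
proof (rule sigma_finite_measure.density_zero[OF _ g])
  show "sigma_finite_measure circle" by (rule sigma_finite_circle)
  \<comment> \<open>The constant 1 is a test function; this case handles complements below.\<close>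
  have total: "(\<integral>t. g t \<partial>circle) = 0"
    using Z[of "\<lambda>_. 1" "\<lambda>_. 0"] by (simp add: C1_periodic_def periodic_2pi_def)
  have borel: "(\<integral>t. indicator B t *\<^sub>R g t \<partial>circle) = 0" if "B \<in> sets borel" for B
    using that
  proof (induction rule: borel_set_induct)
    case empty
    show ?case by simp
  next
    case (interval a b)
    let ?a = "max 0 a" and ?b = "min (2 * pi) b"
    \<comment> \<open>After clipping to one period, the closed and the open interval differ at most
      in the four excluded points.\<close>
    have "AE t in circle. indicat_real {a..b} t *\<^sub>R g t = indicat_real {?a<..<?b} t *\<^sub>R g t"
      using AE_circle_neq[of a] AE_circle_neq[of b] AE_circle_neq[of 0] AE_circle_neq[of "2*pi"] AE_space
      by eventually_elim (auto simp: indicator_def)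
    then have "(\<integral>t. indicator {a..b} t *\<^sub>R g t \<partial>circle) = (\<integral>t. indicator {?a<..<?b} t *\<^sub>R g t \<partial>circle)"
      by (intro integral_cong_AE borel_measurable_integrable integrable_indicator_mult[OF g]) auto
    also have "\<dots> = 0"
    proof (cases "?a \<le> ?b")
      case True
      then show ?thesis by (intro integral_open_interval_eq_0[OF g Z]) auto
    next
      case False
      then have e: "{?a<..<?b} = {}" by auto
      show ?thesis unfolding e by simp
    qed
    finally show ?case .
  next
    case (compl A)
    have "(\<integral>t. indicator (- A) t *\<^sub>R g t \<partial>circle) = (\<integral>t. g t - indicator A t *\<^sub>R g t \<partial>circle)"
      by (intro Bochner_Integration.integral_cong) (auto simp: indicator_def)
    also have "\<dots> = 0"
      using compl total by (subst Bochner_Integration.integral_diff[OF g integrable_indicator_mult[OF g]]) auto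
    finally show ?case .
  next
    case (union f)
    \<comment> \<open>Countable additivity is applied in the restricted space, whose measurable sets
      lie in one period, so every \<open>f i\<close> is intersected with it.\<close>
    let ?C = "{0..2 * pi}"
    have eq: "(LINT t:B \<inter> ?C|circle. g t) = (\<integral>t. indicator B t *\<^sub>R g t \<partial>circle)" for B
      unfolding set_lebesgue_integral_def
      by (intro Bochner_Integration.integral_cong) (auto simp: indicator_def)
    have "(LINT t:(\<Union>i. f i \<inter> ?C)|circle. g t) = (\<Sum>i. LINT t:f i \<inter> ?C|circle. g t)"
    proof (rule lebesgue_integral_countable_add)
      have *: "f i \<in> sets lebesgue" for i using union by simp
      then show "f i \<inter> ?C \<in> sets circle" for i
        by (auto simp: sets_restrict_space)
      show "i \<noteq> j \<Longrightarrow> f i \<inter> ?C \<inter> (f j \<inter> ?C) = {}" for i j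
        using union by (auto simp: disjoint_family_on_def)
      show "set_integrable circle (\<Union>i. f i \<inter> ?C) g"
        unfolding set_integrable_def using *
        by (intro integrable_indicator_mult[OF g]) auto
    qed
    also have "(\<Union>i. f i \<inter> ?C) = (\<Union>i. f i) \<inter> ?C" by auto
    finally show ?case using union by (simp add: eq)
  qed
  fix A assume A: "A \<in> sets circle"
  then have "A \<in> sets lebesgue" by (auto simp: sets_restrict_space)
  then obtain B T where BT: "fsigma B" "T \<in> null_sets lebesgue" "B \<union> T = A" "disjnt B T"
    by (rule lebesgue_set_almost_fsigma)
  have "AE t in lebesgue. t \<notin> T" using BT(2) by (rule AE_not_in)
  then have "AE t in circle. t \<notin> T" by (subst AE_restrict_space_iff) auto
  then have "AE t in circle. indicat_real A t *\<^sub>R g t = indicat_real B t *\<^sub>R g t"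
    by eventually_elim (use BT in \<open>auto simp: indicator_def\<close>)
  moreover have B: "B \<in> sets borel" using BT(1)
    by (cases rule: fsigma.cases) (auto intro!: sets.countable_UN dest: borel_closed)
  ultimately have "(LINT t:A|circle. g t) = (\<integral>t. indicator B t *\<^sub>R g t \<partial>circle)"
    unfolding set_lebesgue_integral_def using \<open>A \<in> sets lebesgue\<close>
    by (intro integral_cong_AE borel_measurable_integrable integrable_indicator_mult[OF g]) auto
  then show "(LINT t:A|circle. g t) = 0" using borel[OF B] by simp
qed

text \<open>\<open>F (t + 2 * pi) - F t\<close> has derivative 0 by periodicity of \<open>g\<close>,
  so it equals its value at 0, which is the vanishing integral of \<open>g\<close>.\<close>

lemma periodic_antiderivative:
  fixes g :: "real \<Rightarrow> 'a::euclidean_space"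
  assumes g: "continuous_on UNIV g" "periodic_2pi g" "(\<integral>t. g t \<partial>circle) = 0"
  obtains F where "periodic_2pi F" "\<And>t. (F has_vector_derivative g t) (at t)"
proof -
  obtain F where F: "\<And>t. (F has_vector_derivative g t) (at t)"
    using einterval_antiderivative[of "-\<infinity>" \<infinity> g] g
    by (auto simp: continuous_on_eq_continuous_at)
  have "(g has_integral F (2 * pi) - F 0) {0..2 * pi}"
    by (rule fundamental_theorem_of_calculus) (auto intro: F has_vector_derivative_at_within)
  moreover have "(g has_integral (\<integral>t. g t \<partial>circle)) {0..2 * pi}"
    using g by (intro has_integral_integral_lebesgue_on integrable_circle_continuous)
      (auto intro: continuous_on_subset)
  ultimately have "F (2 * pi) - F 0 = (\<integral>t. g t \<partial>circle)"
    by (rule has_integral_unique)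
  then have per0: "F (2 * pi) = F 0"
    using g(3) by simp
  have "((\<lambda>t. F (t + 2 * pi) - F t) has_vector_derivative 0) (at t within UNIV)" for t
  proof -
    have "((\<lambda>t. F (t + 2 * pi)) has_vector_derivative g t) (at t)"
    proof -
      have "((F \<circ> (\<lambda>t. t + 2 * pi)) has_vector_derivative (1 *\<^sub>R g (t + 2 * pi))) (at t)"
        by (rule vector_diff_chain_at[OF _ F]) (auto intro!: derivative_eq_intros)
      then show ?thesis using g(2) by (simp add: periodic_2pi_def o_def)
    qed
    from has_vector_derivative_diff[OF this F[of t]] show ?thesis by simp
  qed
  then obtain c where c: "\<And>t. t \<in> UNIV \<Longrightarrow> F (t + 2 * pi) - F t = c"
    by (rule has_vector_derivative_zero_constant[OF convex_UNIV]) blast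
  have "F (t + 2 * pi) = F t" for t
    using c[of t] c[of 0] per0 by simp
  then have "periodic_2pi F"
    unfolding periodic_2pi_def by blast
  then show ?thesis using F by (rule that)
qed

text \<open>The du Bois-Reymond lemma. A test function minus its mean is the derivative of another
  test function, so \<open>f - mean f\<close> integrates to 0 against every test function and the
  fundamental lemma applies.\<close>

lemma AE_circle_const_if_test_integrals_0:
  fixes f :: "real \<Rightarrow> 'a::euclidean_space"
  assumes f: "integrable circle f"
    and Z: "\<And>\<phi> \<phi>'. C1_periodic \<phi> \<phi>' \<Longrightarrow> (\<integral>t. \<phi>' t *\<^sub>R f t \<partial>circle) = 0"
  shows "\<exists>c. AE t in circle. f t = c"
proof -
  define mean where "mean g = (1 / (2 * pi)) *\<^sub>R (\<integral>t. g t \<partial>circle)" for g :: "real \<Rightarrow> 'a"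
  have mc: "measure circle {0..2 * pi} = 2 * pi"
    by (simp add: measure_restrict_space)
  have "AE t in circle. f t - mean f = 0"
  proof (rule AE_eq_0_if_test_integrals_0)
    show int1: "integrable circle (\<lambda>t. f t - mean f)"
      using f by (auto intro!: integrable_circle_continuous)
    fix \<psi> \<psi>' assume C: "C1_periodic \<psi> \<psi>'"
    note cont = C1_periodicD(4)[OF C]
    define m where "m = (\<integral>t. \<psi> t \<partial>circle) / (2 * pi)"
    have i\<psi>: "integrable circle \<psi>"
      using cont by (intro integrable_circle_continuous) (auto intro: continuous_on_subset)
    have "(\<integral>t. \<psi> t - m \<partial>circle) = (\<integral>t. \<psi> t \<partial>circle) - (\<integral>t. m \<partial>circle)"
      using i\<psi> by (intro Bochner_Integration.integral_diff) (auto intro!: integrable_circle_continuous)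
    also have "\<dots> = 0" by (simp add: mc m_def)
    finally have zero: "(\<integral>t. \<psi> t - m \<partial>circle) = 0" .
    obtain \<Phi> where per: "periodic_2pi \<Phi>"
      and \<Phi>d: "\<And>t. (\<Phi> has_vector_derivative \<psi> t - m) (at t)"
    proof (rule periodic_antiderivative[OF _ _ zero])
      show "continuous_on UNIV (\<lambda>t. \<psi> t - m)" using cont by (intro continuous_intros)
      show "periodic_2pi (\<lambda>t. \<psi> t - m)"
        using C1_periodicD(1)[OF C] by (simp add: periodic_2pi_def)
    qed metis
    have "C1_periodic \<Phi> (\<lambda>t. \<psi> t - m)"
      using per \<Phi>d cont
      by (intro C1_periodicI)
        (auto simp: has_real_derivative_iff_has_vector_derivative intro!: continuous_intros)
    then have z: "(\<integral>t. (\<psi> t - m) *\<^sub>R f t \<partial>circle) = 0" by (rule Z)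
    have i1: "integrable circle (\<lambda>t. \<psi> t *\<^sub>R f t)" "integrable circle (\<lambda>t. m *\<^sub>R f t)"
      "integrable circle (\<lambda>t. \<psi> t *\<^sub>R mean f)"
      using integrable_circle_mult[OF cont f] f i\<psi> by auto
    have "(\<integral>t. \<psi> t *\<^sub>R (f t - mean f) \<partial>circle) = (\<integral>t. \<psi> t *\<^sub>R f t \<partial>circle) - (\<integral>t. \<psi> t \<partial>circle) *\<^sub>R mean f"
      using i1 i\<psi> by (simp add: scaleR_diff_right)
    also have "(\<integral>t. \<psi> t \<partial>circle) *\<^sub>R mean f = m *\<^sub>R (\<integral>t. f t \<partial>circle)"
      by (simp add: mean_def m_def)
    also have "(\<integral>t. \<psi> t *\<^sub>R f t \<partial>circle) = m *\<^sub>R (\<integral>t. f t \<partial>circle)"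
      using z i1 by (simp add: scaleR_diff_left)
    finally show "(\<integral>t. \<psi> t *\<^sub>R (f t - mean f) \<partial>circle) = 0" by simp
  qed
  then show ?thesis by (intro exI[of _ "mean f"]) auto
qed

section \<open>Calculus of weak derivatives\<close>

lemma borel_measurable_circle_id [measurable]: "(\<lambda>t. t) \<in> borel_measurable circle"
  using id_borel_measurable_lebesgue_on[of "{0..2 * pi}"] by (simp add: id_def)

lemma has_weak_derivative_unique:
  fixes f g h :: "real \<Rightarrow> 'a::euclidean_space"
  assumes "has_weak_derivative f g" "has_weak_derivative f h"
  shows "AE t in circle. g t = h t"
proof -
  note g = has_weak_derivativeD[OF assms(1)]
  note h = has_weak_derivativeD[OF assms(2)]
  have "AE t in circle. g t - h t = 0"
  proof (rule AE_eq_0_if_test_integrals_0)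
    show "integrable circle (\<lambda>t. g t - h t)" using g h by auto
    fix \<phi> \<phi>' assume C: "C1_periodic \<phi> \<phi>'"
    have "(\<integral>t. \<phi> t *\<^sub>R g t \<partial>circle) = (\<integral>t. \<phi> t *\<^sub>R h t \<partial>circle)"
      using g(3)[OF C] h(3)[OF C] by simp
    then show "(\<integral>t. \<phi> t *\<^sub>R (g t - h t) \<partial>circle) = 0"
      using integrable_circle_mult[OF C1_periodicD(4)[OF C] g(2)]
        integrable_circle_mult[OF C1_periodicD(4)[OF C] h(2)]
      by (simp add: scaleR_diff_right)
  qed
  then show ?thesis by simp
qed

lemma has_weak_derivative_cong_AE:
  fixes f g :: "real \<Rightarrow> 'a::euclidean_space"
  assumes fg: "has_weak_derivative f g"
    and f': "integrable circle f'" "AE t in circle. f t = f' t"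
    and g': "integrable circle g'" "AE t in circle. g t = g' t"
  shows "has_weak_derivative f' g'"
  unfolding has_weak_derivative_altdef
proof (intro conjI allI impI f' g')
  fix \<phi> \<phi>' assume C: "C1_periodic \<phi> \<phi>'"
  note i = integrable_circle_mult[OF C1_periodicD(3)[OF C]] integrable_circle_mult[OF C1_periodicD(4)[OF C]]
  note D = has_weak_derivativeD[OF fg]
  have "(\<integral>t. \<phi>' t *\<^sub>R f t \<partial>circle) = (\<integral>t. \<phi>' t *\<^sub>R f' t \<partial>circle)"
    using i(1) f' D by (intro integral_cong_AE borel_measurable_integrable) auto
  moreover have "(\<integral>t. \<phi> t *\<^sub>R g t \<partial>circle) = (\<integral>t. \<phi> t *\<^sub>R g' t \<partial>circle)"
    using i(2) g' D by (intro integral_cong_AE borel_measurable_integrable) auto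
  ultimately show "(\<integral>t. \<phi>' t *\<^sub>R f' t \<partial>circle) = - (\<integral>t. \<phi> t *\<^sub>R g' t \<partial>circle)"
    using D(3)[OF C] by simp
qed

lemma has_weak_derivative_wderiv:
  "has_weak_derivative f g \<Longrightarrow> has_weak_derivative f (wderiv f)"
  using someI[of "has_weak_derivative f" g] by (simp add: wderiv_def)

lemma AE_wderiv_eq:
  "has_weak_derivative f g \<Longrightarrow> AE t in circle. wderiv f t = g t"
  using has_weak_derivative_unique has_weak_derivative_wderiv by blast

text \<open>\<open>wderiv f\<close> is an arbitrary choice that agrees with \<open>g\<close> only
  almost everywhere; this carries the second derivative over to it, so that
  \<open>wderiv (wderiv f)\<close> can be computed.\<close>

lemma has_weak_derivative_of_wderiv:
  assumes "has_weak_derivative f g" "has_weak_derivative g h"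
  shows "has_weak_derivative (wderiv f) h"
proof (rule has_weak_derivative_cong_AE[OF assms(2)])
  show "integrable circle (wderiv f)"
    using has_weak_derivativeD(2) has_weak_derivative_wderiv[OF assms(1)] by blast
  show "AE t in circle. g t = wderiv f t"
    using AE_wderiv_eq[OF assms(1)] by eventually_elim simp
qed (use has_weak_derivativeD(2)[OF assms(2)] in auto)

lemma has_weak_derivative_add:
  assumes "has_weak_derivative f f'" "has_weak_derivative g g'"
  shows "has_weak_derivative (\<lambda>t. f t + g t) (\<lambda>t. f' t + g' t)"
  unfolding has_weak_derivative_altdef
proof (intro conjI allI impI)
  note F = has_weak_derivativeD[OF assms(1)]
  note G = has_weak_derivativeD[OF assms(2)]
  show "integrable circle (\<lambda>t. f t + g t)" "integrable circle (\<lambda>t. f' t + g' t)"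
    using F G by auto
  fix \<phi> \<phi>' assume C: "C1_periodic \<phi> \<phi>'"
  note i = integrable_circle_mult[OF C1_periodicD(3)[OF C]] integrable_circle_mult[OF C1_periodicD(4)[OF C]]
  show "(\<integral>t. \<phi>' t *\<^sub>R (f t + g t) \<partial>circle) = - (\<integral>t. \<phi> t *\<^sub>R (f' t + g' t) \<partial>circle)"
    using F(3)[OF C] G(3)[OF C] i(1)[OF F(1)] i(1)[OF G(1)] i(2)[OF F(2)] i(2)[OF G(2)]
    by (simp add: scaleR_add_right)
qed

lemma has_weak_derivative_scaleR_const:
  assumes "has_weak_derivative f f'"
  shows "has_weak_derivative (\<lambda>t. c *\<^sub>R f t) (\<lambda>t. c *\<^sub>R f' t)"
  unfolding has_weak_derivative_altdef
proof (intro conjI allI impI)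
  note F = has_weak_derivativeD[OF assms(1)]
  show "integrable circle (\<lambda>t. c *\<^sub>R f t)" "integrable circle (\<lambda>t. c *\<^sub>R f' t)"
    using F by auto
  fix \<phi> \<phi>' assume C: "C1_periodic \<phi> \<phi>'"
  show "(\<integral>t. \<phi>' t *\<^sub>R (c *\<^sub>R f t) \<partial>circle) = - (\<integral>t. \<phi> t *\<^sub>R (c *\<^sub>R f' t) \<partial>circle)"
    using F(3)[OF C] by (simp add: scaleR_left_commute[of _ c] del: scaleR_scaleR)
qed

lemma has_weak_derivative_diff:
  assumes "has_weak_derivative f f'" "has_weak_derivative g g'"
  shows "has_weak_derivative (\<lambda>t. f t - g t) (\<lambda>t. f' t - g' t)"
  using has_weak_derivative_add[OF assms(1) has_weak_derivative_scaleR_const[OF assms(2), of "-1"]]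
  by simp

text \<open>Integration by parts over one period; the boundary terms cancel because both factors are
  periodic.\<close>

lemma has_weak_derivative_classical:
  fixes f g :: "real \<Rightarrow> 'a::euclidean_space"
  assumes f: "periodic_2pi f" "\<And>t. (f has_vector_derivative g t) (at t)" and g: "continuous_on UNIV g"
  shows "has_weak_derivative f g"
  unfolding has_weak_derivative_altdef
proof (intro conjI allI impI)
  have cf: "continuous_on UNIV f"
    using f(2) by (meson continuous_on_eq_continuous_at has_vector_derivative_continuous open_UNIV)
  show i: "integrable circle f" "integrable circle g"
    using cf g by (auto intro!: integrable_circle_continuous intro: continuous_on_subset)
  fix \<phi> \<phi>' assume C: "C1_periodic \<phi> \<phi>'"
  note ii = integrable_circle_mult[OF C1_periodicD(3)[OF C] i(1)] integrable_circle_mult[OF C1_periodicD(4)[OF C] i(2)]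
  have "((\<lambda>t. \<phi> t *\<^sub>R g t + \<phi>' t *\<^sub>R f t) has_integral \<phi> (2 * pi) *\<^sub>R f (2 * pi) - \<phi> 0 *\<^sub>R f 0) {0..2 * pi}"
  proof (rule fundamental_theorem_of_calculus)
    fix t assume "t \<in> {0..2 * pi}"
    show "((\<lambda>t. \<phi> t *\<^sub>R f t) has_vector_derivative \<phi> t *\<^sub>R g t + \<phi>' t *\<^sub>R f t) (at t within {0..2 * pi})"
      by (intro has_vector_derivative_scaleR has_vector_derivative_at_within[OF f(2)])
        (use C1_periodicD(2)[OF C] has_field_derivative_at_within in blast)
  qed simp
  moreover have "\<phi> (2 * pi) = \<phi> 0" "f (2 * pi) = f 0"
    using f(1) C1_periodicD(1)[OF C] by (metis add_0 periodic_2pi_def)+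
  ultimately have "((\<lambda>t. \<phi> t *\<^sub>R g t + \<phi>' t *\<^sub>R f t) has_integral 0) {0..2 * pi}"
    by simp
  moreover have "((\<lambda>t. \<phi> t *\<^sub>R g t + \<phi>' t *\<^sub>R f t) has_integral
      (\<integral>t. \<phi> t *\<^sub>R g t + \<phi>' t *\<^sub>R f t \<partial>circle)) {0..2 * pi}"
    using ii by (intro has_integral_integral_lebesgue_on) auto
  ultimately have "(\<integral>t. \<phi> t *\<^sub>R g t + \<phi>' t *\<^sub>R f t \<partial>circle) = 0"
    using has_integral_unique by blast
  then show "(\<integral>t. \<phi>' t *\<^sub>R f t \<partial>circle) = - (\<integral>t. \<phi> t *\<^sub>R g t \<partial>circle)"
    using ii by (simp add: eq_neg_iff_add_eq_0 add.commute)
qed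

section \<open>Periodic extension and continuous representatives\<close>

lemma periodic_2pi_of_int:
  assumes "periodic_2pi f"
  shows "f (t + of_int k * (2 * pi)) = f t"
proof -
  interpret periodic_fun_simple f "2 * pi"
    using assms by unfold_locales (simp add: periodic_2pi_def)
  show ?thesis by (rule plus_of_int)
qed

lemma periodic_2pi_representative:
  assumes "periodic_2pi f"
  obtains s k where "0 \<le> s" "s < 2 * pi" "t = s + of_int k * (2 * pi)" "f t = f s"
proof
  let ?k = "\<lfloor>t / (2 * pi)\<rfloor>"
  let ?s = "t - of_int ?k * (2 * pi)"
  show "0 \<le> ?s" "?s < 2 * pi"
    using floor_divide_lower[of "2 * pi" t] floor_divide_upper[of "2 * pi" t]
    by (simp_all add: algebra_simps)
  show "t = ?s + of_int ?k * (2 * pi)" by simp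
  show "f t = f ?s"
    using periodic_2pi_of_int[OF assms, of ?s ?k] by simp
qed

lemma periodic_2pi_eqI:
  assumes "periodic_2pi f" "periodic_2pi g" "\<And>t. 0 \<le> t \<Longrightarrow> t < 2 * pi \<Longrightarrow> f t = g t"
  shows "f = g"
proof
  fix t
  obtain s k where s: "0 \<le> s" "s < 2 * pi" "t = s + of_int k * (2 * pi)" "f t = f s"
    by (rule periodic_2pi_representative[OF assms(1)])
  show "f t = g t"
    using assms(3)[OF s(1,2)] s(3,4) periodic_2pi_of_int[OF assms(2), of s k] by simp
qed

text \<open>Two adjacent copies of \<open>W\<close> glue at 0 by the endpoint condition, which gives
  continuity on an open interval of length \<open>4 * pi\<close>. Every real number is a translate
  of a point of it by a multiple of the period.\<close>

lemma periodic_continuous_extension: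
  fixes W :: "real \<Rightarrow> 'a::real_normed_vector"
  assumes W: "continuous_on {0..2 * pi} W" "W 0 = W (2 * pi)"
  obtains V where "continuous_on UNIV V" "periodic_2pi V" "\<And>t. t \<in> {0..2 * pi} \<Longrightarrow> V t = W t"
proof
  define V where "V t = W (t - of_int \<lfloor>t / (2 * pi)\<rfloor> * (2 * pi))" for t
  have "(t + 2 * pi) / (2 * pi) = t / (2 * pi) + 1" for t
    by (simp add: field_simps)
  then show per: "periodic_2pi V"
    by (simp add: periodic_2pi_def V_def algebra_simps)
  show eq: "V t = W t" if "t \<in> {0..2 * pi}" for t
  proof (cases "t = 2 * pi")
    case True
    then show ?thesis using W(2) by (simp add: V_def)
  next
    case False
    then have "\<lfloor>t / (2 * pi)\<rfloor> = 0"
      using that by (simp add: floor_eq_iff field_simps)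
    then show ?thesis by (simp add: V_def)
  qed
  have c1: "continuous_on {0..2 * pi} V"
  proof -
    have "continuous_on {0..2 * pi} V \<longleftrightarrow> continuous_on {0..2 * pi} W"
      by (intro continuous_on_cong refl eq)
    then show ?thesis using W(1) by simp
  qed
  have "continuous_on {- (2 * pi)..0} (\<lambda>t. V (t + 2 * pi))"
    by (rule continuous_on_compose2[OF c1]) (auto intro!: continuous_intros)
  then have c2: "continuous_on {- (2 * pi)..0} V"
    using per by (simp add: periodic_2pi_def)
  have "continuous_on ({- (2 * pi)..0} \<union> {0..2 * pi}) V"
    by (intro continuous_on_closed_Un c1 c2) auto
  then have "continuous_on {- (2 * pi)<..<2 * pi} V"
    by (rule continuous_on_subset) auto
  then have c3: "isCont V t" if "t \<in> {- (2 * pi)<..<2 * pi}" for t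
    using that by (simp add: continuous_on_eq_continuous_at)
  have "isCont V t" for t
  proof -
    obtain s k where s: "0 \<le> s" "s < 2 * pi" "t = s + of_int k * (2 * pi)" "V t = V s"
      by (rule periodic_2pi_representative[OF per])
    have "isCont V (t - of_int k * (2 * pi))"
      using s by (intro c3) auto
    moreover have "isCont (\<lambda>x. x - of_int k * (2 * pi)) t"
      by (intro continuous_intros)
    ultimately have "isCont (\<lambda>x. V (x - of_int k * (2 * pi))) t"
      using isCont_o2 by blast
    moreover have "V (x - of_int k * (2 * pi)) = V x" for x
      using periodic_2pi_of_int[OF per, of x "- k"] by simp
    ultimately show ?thesis by simp
  qed
  then show "continuous_on UNIV V"
    by (simp add: continuous_on_eq_continuous_at)
qed

text \<open>The set of agreement is closed and fills almost all of the open period, hence all of it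
  and its closure; periodicity does the rest.\<close>

lemma continuous_AE_circle_eq:
  fixes f g :: "real \<Rightarrow> 'a::real_normed_vector"
  assumes "continuous_on UNIV f" "continuous_on UNIV g" "periodic_2pi f" "periodic_2pi g"
    and ae: "AE t in circle. f t = g t"
  shows "f = g"
proof -
  have "AE t in lebesgue. t \<in> {0..2 * pi} \<longrightarrow> f t = g t"
    using ae by (subst (asm) AE_restrict_space_iff) auto
  then have "AE t in lborel. t \<in> {0..2 * pi} \<longrightarrow> f t = g t"
    by (simp add: AE_completion_iff)
  then have "AE t\<in>{0<..<2 * pi} in lborel. t \<in> {t. f t = g t}"
    by eventually_elim auto
  moreover have cl: "closed {t. f t = g t}"
    using assms by (intro closed_Collect_eq)
  ultimately have "t \<in> {t. f t = g t}" if "t \<in> {0<..<2 * pi}" for t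
    using mem_closed_if_AE_lebesgue_open[of "{0<..<2 * pi}" "{t. f t = g t}" t] that
    by (simp add: AE_completion_iff)
  then have "closure {0<..<2 * pi} \<subseteq> {t. f t = g t}"
    using cl by (intro closure_minimal) auto
  then show ?thesis
    using assms by (intro periodic_2pi_eqI) (auto simp: subset_iff)
qed

text \<open>As \<open>g\<close> is merely integrable, the primitive is not differentiated pointwise.
  Fubini on the triangle \<open>s \<le> t\<close> moves the integration onto the smooth factor,
  where the fundamental theorem of calculus is available.\<close>

lemma has_weak_derivative_indefinite_integral:
  fixes g :: "real \<Rightarrow> 'a::euclidean_space"
  assumes g: "integrable circle g" "(\<integral>t. g t \<partial>circle) = 0"
  shows "has_weak_derivative (\<lambda>t. \<integral>s. g s \<partial>lebesgue_on {0..t}) g"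
  unfolding has_weak_derivative_altdef
proof (intro conjI allI impI g)
  let ?W = "\<lambda>t. \<integral>s. g s \<partial>lebesgue_on {0..t}"
  have "continuous_on {0..2 * pi} ?W"
    by (rule indefinite_integral_continuous_real[OF g(1)])
  then show "integrable circle ?W" by (rule integrable_circle_continuous)
  fix \<phi> \<phi>' assume C: "C1_periodic \<phi> \<phi>'"
  define K where "K t s = \<phi>' t *\<^sub>R (if s \<le> t then g s else 0)" for t s
  interpret c: sigma_finite_measure circle by (rule sigma_finite_circle)
  interpret pair_sigma_finite circle circle ..
  have i': "integrable circle \<phi>'"
    using C1_periodicD(3)[OF C] by (auto intro!: integrable_circle_continuous intro: continuous_on_subset)
  note [measurable] = borel_measurable_integrable[OF g(1)] borel_measurable_integrable[OF i']
  have "integrable (circle \<Otimes>\<^sub>M circle) (\<lambda>(t, s). \<bar>\<phi>' t\<bar> * norm (g s))"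
    using g i' by (intro Fubini_integrable) auto
  then have K: "integrable (circle \<Otimes>\<^sub>M circle) (\<lambda>(t, s). K t s)"
  proof (rule Bochner_Integration.integrable_bound)
    show "(\<lambda>(t, s). K t s) \<in> borel_measurable (circle \<Otimes>\<^sub>M circle)"
      unfolding K_def by measurable
  qed (auto simp: K_def intro!: AE_I2)
  have "(\<integral>t. \<phi>' t *\<^sub>R ?W t \<partial>circle) = (\<integral>t. (\<integral>s. K t s \<partial>circle) \<partial>circle)"
  proof (rule Bochner_Integration.integral_cong)
    fix t assume "t \<in> space circle"
    then have "?W t = (\<integral>s. (if s \<in> {0..t} then g s else 0) \<partial>circle)"
      by (intro integral_restrict[symmetric]) auto
    also have "\<dots> = (\<integral>s. (if s \<le> t then g s else 0) \<partial>circle)"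
      by (intro Bochner_Integration.integral_cong) auto
    finally show "\<phi>' t *\<^sub>R ?W t = (\<integral>s. K t s \<partial>circle)" by (simp add: K_def)
  qed simp
  also have "\<dots> = (\<integral>s. (\<integral>t. K t s \<partial>circle) \<partial>circle)"
    using Fubini_integral[OF K] by simp
  also have "\<dots> = (\<integral>s. (\<phi> (2 * pi) - \<phi> s) *\<^sub>R g s \<partial>circle)"
  proof (rule Bochner_Integration.integral_cong)
    fix s assume "s \<in> space circle"
    then have s: "0 \<le> s" "s \<le> 2 * pi" by auto
    have "(\<integral>t. K t s \<partial>circle) = (\<integral>t. (if t \<in> {s..2 * pi} then \<phi>' t else 0) *\<^sub>R g s \<partial>circle)"
      by (intro Bochner_Integration.integral_cong) (auto simp: K_def)
    also have "\<dots> = (\<integral>t. (if t \<in> {s..2 * pi} then \<phi>' t else 0) \<partial>circle) *\<^sub>R g s"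
    proof (intro integral_scaleR_left)
      show "integrable circle (\<lambda>t. if t \<in> {s..2 * pi} then \<phi>' t else 0)"
        using integrable_indicator_mult[OF i', of "{s..2 * pi}"]
        unfolding indicator_scaleR_eq_if by simp
    qed
    also have "(\<integral>t. (if t \<in> {s..2 * pi} then \<phi>' t else 0) \<partial>circle) = (\<integral>t. \<phi>' t \<partial>lebesgue_on {s..2 * pi})"
      using s by (intro integral_restrict) auto
    also have "\<dots> = \<phi> (2 * pi) - \<phi> s"
    proof (rule has_integral_unique)
      show "(\<phi>' has_integral (\<integral>t. \<phi>' t \<partial>lebesgue_on {s..2 * pi})) {s..2 * pi}"
        using C1_periodicD(3)[OF C]
        by (intro has_integral_integral_lebesgue_on continuous_imp_integrable_real)
          (auto intro: continuous_on_subset)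
      show "(\<phi>' has_integral \<phi> (2 * pi) - \<phi> s) {s..2 * pi}"
        using s C1_periodicD(2)[OF C]
        by (intro fundamental_theorem_of_calculus)
          (auto simp: has_real_derivative_iff_has_vector_derivative intro: has_vector_derivative_at_within)
    qed
    finally show "(\<integral>t. K t s \<partial>circle) = (\<phi> (2 * pi) - \<phi> s) *\<^sub>R g s" .
  qed simp
  \<comment> \<open>The term with \<open>\<phi> (2 * pi)\<close> drops out since \<open>g\<close>
    has integral 0.\<close>
  also have "\<dots> = - (\<integral>s. \<phi> s *\<^sub>R g s \<partial>circle)"
    using integrable_circle_mult[OF C1_periodicD(4)[OF C] g(1)] g by (simp add: scaleR_diff_left)
  finally show "(\<integral>t. \<phi>' t *\<^sub>R ?W t \<partial>circle) = - (\<integral>t. \<phi> t *\<^sub>R g t \<partial>circle)" .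
qed

text \<open>Test with the constant 1. This mean-zero property is what makes primitives of weak
  derivatives periodic.\<close>

lemma has_weak_derivative_integral_0:
  assumes "has_weak_derivative f g"
  shows "(\<integral>t. g t \<partial>circle) = 0"
proof -
  have "C1_periodic (\<lambda>_. 1) (\<lambda>_. 0)" by (simp add: C1_periodic_def periodic_2pi_def)
  from has_weak_derivativeD(3)[OF assms this] show ?thesis by simp
qed

lemma has_weak_derivative_same_imp_AE_const:
  fixes f h g :: "real \<Rightarrow> 'a::euclidean_space"
  assumes "has_weak_derivative f g" "has_weak_derivative h g"
  shows "\<exists>c. AE t in circle. f t = h t + c"
proof -
  have d: "has_weak_derivative (\<lambda>t. f t - h t) (\<lambda>t. 0)"
    using has_weak_derivative_diff[OF assms] by simp
  have "\<exists>c. AE t in circle. f t - h t = c"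
    using has_weak_derivativeD[OF d] by (intro AE_circle_const_if_test_integrals_0) auto
  then show ?thesis by (simp add: algebra_simps)
qed

text \<open>\<open>f\<close> differs from the primitive \<open>W\<close> of \<open>g\<close> by a
  constant almost everywhere. \<open>W\<close> is continuous on one period and, since
  \<open>g\<close> has mean zero, takes the value 0 at both ends, so it extends
  periodically.\<close>

lemma weakly_differentiable_continuous_representative:
  fixes f g :: "real \<Rightarrow> 'a::euclidean_space"
  assumes "has_weak_derivative f g"
  obtains V where "continuous_on UNIV V" "periodic_2pi V" "AE t in circle. f t = V t"
proof -
  define W where "W t = (\<integral>s. g s \<partial>lebesgue_on {0..t})" for t
  note g = has_weak_derivativeD(2)[OF assms] has_weak_derivative_integral_0[OF assms]
  have "has_weak_derivative W g"
    unfolding W_def by (rule has_weak_derivative_indefinite_integral[OF g])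
  then obtain c where c: "AE t in circle. f t = W t + c"
    using has_weak_derivative_same_imp_AE_const[OF assms] by blast
  have "(g has_integral W 0) {0..0}"
    unfolding W_def by (intro has_integral_integral_lebesgue_on integrable_subinterval[OF g(1)]) auto
  moreover have "(g has_integral 0) {0..0}"
    using has_integral_refl(2)[of g 0] by simp
  ultimately have "W 0 = 0"
    by (rule has_integral_unique)
  then obtain V where V: "continuous_on UNIV V" "periodic_2pi V" "\<And>t. t \<in> {0..2 * pi} \<Longrightarrow> V t = W t"
    using periodic_continuous_extension[of W] indefinite_integral_continuous_real[OF g(1)] g(2)
    unfolding W_def by metis
  show ?thesis
  proof (rule that[of "\<lambda>t. V t + c"])
    show "AE t in circle. f t = V t + c"
      using c AE_space by eventually_elim (use V in auto)
  qed (use V in \<open>auto intro!: continuous_intros simp: periodic_2pi_def\<close>)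
qed

text \<open>A classical periodic antiderivative of \<open>g\<close> has the same weak derivative as
  \<open>f\<close>. The two differ by a constant almost everywhere, hence everywhere by
  continuity.\<close>

lemma weak_imp_classical_derivative:
  fixes f g :: "real \<Rightarrow> 'a::euclidean_space"
  assumes fg: "has_weak_derivative f g"
    and f: "continuous_on UNIV f" "periodic_2pi f" and g: "continuous_on UNIV g" "periodic_2pi g"
  shows "(f has_vector_derivative g t) (at t)"
proof -
  obtain G where G: "periodic_2pi G" "\<And>t. (G has_vector_derivative g t) (at t)"
    using periodic_antiderivative[OF g has_weak_derivative_integral_0[OF fg]] by blast
  have "has_weak_derivative G g"
    using G g by (intro has_weak_derivative_classical)
  then obtain c where c: "AE t in circle. f t = G t + c"
    using has_weak_derivative_same_imp_AE_const[OF fg] by blast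
  have "continuous_on UNIV G"
    using G(2) by (meson continuous_on_eq_continuous_at has_vector_derivative_continuous open_UNIV)
  then have "f = (\<lambda>t. G t + c)"
    using f G c by (intro continuous_AE_circle_eq) (auto intro!: continuous_intros simp: periodic_2pi_def)
  then show ?thesis
    using G(2)[of t] by (simp add: has_vector_derivative_def)
      (auto intro!: derivative_eq_intros)
qed

section \<open>Periods of one-dimensional cubic oscillators\<close>

text \<open>\<open>N\<close> weighted with \<open>exp (- K * t)\<close> decreases forward in time
  and weighted with \<open>exp (K * t)\<close> increases up to time 0, so \<open>N t \<le> 0\<close>
  on both sides of 0.\<close>

lemma gronwall_zero:
  fixes N N' :: "real \<Rightarrow> real"
  assumes N: "\<And>t. (N has_real_derivative N' t) (at t)" and "\<And>t. N t \<ge> 0"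
    and le: "\<And>t. \<bar>N' t\<bar> \<le> K * N t" and "N 0 = 0"
  shows "N t = 0"
proof -
  have "N t \<le> 0"
  proof (cases "t \<ge> 0")
    case True
    have "N t * exp (- K * t) \<le> N 0 * exp (- K * 0)"
    proof (rule DERIV_nonpos_imp_nonincreasing[OF True])
      fix s
      have "((\<lambda>s. N s * exp (- K * s)) has_real_derivative (N' s - K * N s) * exp (- K * s)) (at s)"
        by (auto intro!: derivative_eq_intros N simp: algebra_simps)
      moreover have "(N' s - K * N s) * exp (- K * s) \<le> 0"
        using le[of s] by (intro mult_nonpos_nonneg) auto
      ultimately show "\<exists>y. ((\<lambda>s. N s * exp (- K * s)) has_real_derivative y) (at s) \<and> y \<le> 0"
        by blast
    qed
    then show ?thesis using assms(4) by (simp add: mult_le_0_iff)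
  next
    case False
    then have "t \<le> 0" by simp
    then have "N t * exp (K * t) \<le> N 0 * exp (K * 0)"
    proof (rule DERIV_nonneg_imp_nondecreasing)
      fix s
      have "((\<lambda>s. N s * exp (K * s)) has_real_derivative (N' s + K * N s) * exp (K * s)) (at s)"
        by (auto intro!: derivative_eq_intros N simp: algebra_simps)
      moreover have "(N' s + K * N s) * exp (K * s) \<ge> 0"
        using le[of s] by (intro mult_nonneg_nonneg) auto
      ultimately show "\<exists>y. ((\<lambda>s. N s * exp (K * s)) has_real_derivative y) (at s) \<and> y \<ge> 0"
        by blast
    qed
    then show ?thesis using assms(4) by (simp add: mult_le_0_iff)
  qed
  then show ?thesis using assms(2)[of t] by simp
qed

text \<open>Gronwall for the squared distance in the phase plane. The Lipschitz bound is required
  only along the two solutions, which allows the quadratic force of the application.\<close>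

lemma second_order_ode_unique:
  fixes y z :: "real \<Rightarrow> real"
  assumes y: "\<And>t. (y has_real_derivative y' t) (at t)" "\<And>t. (y' has_real_derivative f (y t)) (at t)"
    and z: "\<And>t. (z has_real_derivative z' t) (at t)" "\<And>t. (z' has_real_derivative f (z t)) (at t)"
    and L: "\<And>t. \<bar>f (y t) - f (z t)\<bar> \<le> L * \<bar>y t - z t\<bar>"
    and init: "y 0 = z 0" "y' 0 = z' 0"
  shows "y t = z t"
proof -
  define N where "N t = (y t - z t)\<^sup>2 + (y' t - z' t)\<^sup>2" for t
  define N' where "N' t = 2 * (y t - z t) * (y' t - z' t) + 2 * (y' t - z' t) * (f (y t) - f (z t))" for t
  have "N t = 0"
  \<comment> \<open>\<open>L\<close> carries no sign assumption, so its absolute value enters the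
    Gronwall constant.\<close>
  proof (rule gronwall_zero[where N = N and N' = N' and K = "1 + \<bar>L\<bar>"])
    show "(N has_real_derivative N' t) (at t)" for t
      unfolding N_def N'_def by (auto intro!: derivative_eq_intros y z simp: algebra_simps)
    show "N t \<ge> 0" for t by (simp add: N_def)
    show "N 0 = 0" using init by (simp add: N_def)
    show "\<bar>N' t\<bar> \<le> (1 + \<bar>L\<bar>) * N t" for t
    proof -
      define w v where "w = \<bar>y t - z t\<bar>" and "v = \<bar>y' t - z' t\<bar>"
      have wv: "w \<ge> 0" "v \<ge> 0" by (simp_all add: w_def v_def)
      have "\<bar>f (y t) - f (z t)\<bar> \<le> \<bar>L\<bar> * w"
        using L[of t] unfolding w_def
        by (meson abs_ge_self abs_ge_zero mult_right_mono order_trans)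
      then have "2 * v * \<bar>f (y t) - f (z t)\<bar> \<le> 2 * v * (\<bar>L\<bar> * w)"
        using wv by (intro mult_left_mono) auto
      moreover have "\<bar>N' t\<bar> \<le> 2 * w * v + 2 * v * \<bar>f (y t) - f (z t)\<bar>"
        unfolding N'_def w_def v_def
        by (rule order_trans[OF abs_triangle_ineq]) (simp only: abs_mult abs_numeral order_refl)
      ultimately have "\<bar>N' t\<bar> \<le> (1 + \<bar>L\<bar>) * (2 * w * v)" by (simp add: algebra_simps)
      also have "\<dots> \<le> (1 + \<bar>L\<bar>) * (w\<^sup>2 + v\<^sup>2)"
        using sum_squares_bound[of w v] by (intro mult_left_mono) auto
      finally show ?thesis by (simp add: N_def w_def v_def)
    qed
  qed
  then show ?thesis by (simp add: N_def)
qed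

section \<open>Reflection symmetry and period of a cubic oscillator\<close>

text \<open>The energy law determines \<open>u'\<close> only up to sign and does not give uniqueness
  at turning points, so the second-order equation is carried along for the reflection
  argument.\<close>

locale cubic_oscillation =
  fixes u u' :: "real \<Rightarrow> real" and f :: "real \<Rightarrow> real" and a e1 e2 e3 L :: real
  assumes a: "a > 0" and e: "e1 < e2" "e2 < e3"
    and u: "\<And>t. (u has_real_derivative u' t) (at t)"
    and u': "\<And>t. (u' has_real_derivative f (u t)) (at t)"
    and lip: "\<And>s t. \<bar>f (u s) - f (u t)\<bar> \<le> L * \<bar>u s - u t\<bar>"
    and energy: "\<And>t. (u' t)\<^sup>2 = a * (u t - e1) * (u t - e2) * (u t - e3)"
    and range: "\<And>t. e1 \<le> u t \<and> u t \<le> e2"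
begin

text \<open>Both time directions out of a critical point solve the same autonomous second-order
  equation with the same initial value and velocity 0.\<close>

lemma reflection:
  assumes "u' c = 0"
  shows "u (2 * c - t) = u t"
proof -
  have "u (c + s) = u (c - s)" for s
  proof (rule second_order_ode_unique[where y = "\<lambda>s. u (c + s)" and z = "\<lambda>s. u (c - s)"
        and y' = "\<lambda>s. u' (c + s)" and z' = "\<lambda>s. - u' (c - s)" and f = f and L = L and t = s])
    fix t
    show "((\<lambda>s. u (c + s)) has_real_derivative u' (c + t)) (at t)"
      by (rule DERIV_chain'[THEN DERIV_cong, OF _ u]) (auto intro!: derivative_eq_intros)
    show "((\<lambda>s. u' (c + s)) has_real_derivative f (u (c + t))) (at t)"
      by (rule DERIV_chain'[THEN DERIV_cong, OF _ u']) (auto intro!: derivative_eq_intros)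
    show "((\<lambda>s. u (c - s)) has_real_derivative - u' (c - t)) (at t)"
      by (rule DERIV_chain'[THEN DERIV_cong, OF _ u]) (auto intro!: derivative_eq_intros)
    have "((\<lambda>s. u' (c - s)) has_real_derivative - f (u (c - t))) (at t)"
      by (rule DERIV_chain'[THEN DERIV_cong, OF _ u']) (auto intro!: derivative_eq_intros)
    from DERIV_minus[OF this]
    show "((\<lambda>s. - u' (c - s)) has_real_derivative f (u (c - t))) (at t)" by simp
    show "\<bar>f (u (c + t)) - f (u (c - t))\<bar> \<le> L * \<bar>u (c + t) - u (c - t)\<bar>" by (rule lip)
  qed (use assms in auto)
  from this[of "t - c"] show ?thesis by (simp add: algebra_simps)
qed

lemma continuous_u: "continuous_on A u" "continuous_on A u'"
  using u u' by (meson DERIV_continuous_on has_field_derivative_at_within)+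

text \<open>The mean value theorem replaces the integral for the duration: the arcsine coordinate
  gains \<open>pi\<close> over the arc, and its speed in the interior is at least the value at
  \<open>u t = e2\<close>.\<close>

lemma rising_arc_length:
  assumes t: "t1 < t2" "u t1 = e1" "u t2 = e2"
    and between: "\<And>t. t1 < t \<Longrightarrow> t < t2 \<Longrightarrow> e1 < u t \<and> u t < e2"
  shows "sqrt (a * (e3 - e2)) * (t2 - t1) \<le> pi"
proof -
  \<comment> \<open>Inside the arc no factor of the energy vanishes. With one point of positive
    slope from the mean value theorem, the intermediate value theorem makes \<open>u'\<close>
    positive throughout.\<close>
  have nz: "u' t \<noteq> 0" if "t1 < t" "t < t2" for t
  proof -
    have "u t - e1 \<noteq> 0" "u t - e2 \<noteq> 0" "u t - e3 \<noteq> 0"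
      using between[OF that] e by auto
    then show ?thesis using energy[of t] a by auto
  qed
  obtain \<xi> where \<xi>: "t1 < \<xi>" "\<xi> < t2" "u t2 - u t1 = (t2 - t1) * u' \<xi>"
    using MVT2[OF t(1)] u by blast
  then have \<xi>pos: "u' \<xi> > 0"
    using t e by (metis diff_gt_0_iff_gt zero_less_mult_pos)
  have pos: "u' s > 0" if s: "t1 < s" "s < t2" for s
  proof (rule ccontr)
    assume "\<not> u' s > 0"
    moreover have "connected (u' ` {t1<..<t2})"
      by (intro connected_continuous_image continuous_u) simp
    then have "{u' s..u' \<xi>} \<subseteq> u' ` {t1<..<t2}"
      by (rule connected_contains_Icc) (use s \<xi> in auto)
    ultimately have "0 \<in> u' ` {t1<..<t2}"
      using \<xi>pos by (auto simp: subset_iff)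
    then show False using nz by auto
  qed
  define m r where "m = (e1 + e2) / 2" and "r = (e2 - e1) / 2"
  have r: "r > 0" using e by (simp add: r_def)
  define \<theta> where "\<theta> t = arcsin ((u t - m) / r)" for t
  have bnd: "- 1 \<le> (u t - m) / r \<and> (u t - m) / r \<le> 1" for t
    using range[of t] r by (simp add: divide_simps m_def r_def)
  have c\<theta>: "continuous_on {t1..t2} \<theta>"
    unfolding \<theta>_def using bnd r by (intro continuous_intros continuous_u) auto
  have d\<theta>: "(\<theta> has_real_derivative sqrt (a * (e3 - u t))) (at t)" if "t1 < t" "t < t2" for t
  proof -
    \<comment> \<open>\<open>w\<close> occurs both under the root in the derivative of the arcsine
      and as a factor of the energy; it cancels, leaving a speed without singularity at the turning
      points.\<close>
    define w where "w = (u t - e1) * (e2 - u t)"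
    have w: "w > 0" using between[OF that] by (simp add: w_def)
    have strict: "- 1 < (u t - m) / r" "(u t - m) / r < 1"
      using between[OF that] r by (simp_all add: divide_simps m_def r_def)
    have "1 - ((u t - m) / r)\<^sup>2 = w / r\<^sup>2"
    proof -
      have "r\<^sup>2 - (u t - m)\<^sup>2 = w"
        by (simp add: w_def m_def r_def power2_eq_square field_simps)
      moreover have "1 - ((u t - m) / r)\<^sup>2 = (r\<^sup>2 - (u t - m)\<^sup>2) / r\<^sup>2"
        using r by (simp add: diff_divide_distrib[of "r\<^sup>2"] power_divide)
      ultimately show ?thesis by simp
    qed
    then have sq: "sqrt (1 - ((u t - m) / r)\<^sup>2) = sqrt w / r"
      using r by (simp add: real_sqrt_divide)
    have "(u' t)\<^sup>2 = w * (a * (e3 - u t))"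
      unfolding energy w_def by (simp add: algebra_simps)
    then have u't: "u' t = sqrt w * sqrt (a * (e3 - u t))"
      using pos[OF that] by (metis abs_of_pos real_sqrt_abs real_sqrt_mult)
    have "((\<lambda>t. (u t - m) / r) has_real_derivative u' t / r) (at t)"
      using r by (auto intro!: derivative_eq_intros u)
    from DERIV_chain2[OF DERIV_arcsin[OF strict] this]
    have "(\<theta> has_real_derivative inverse (sqrt w / r) * (u' t / r)) (at t)"
      unfolding \<theta>_def sq .
    moreover have "inverse (sqrt w / r) * (u' t / r) = sqrt (a * (e3 - u t))"
      using w r u't by simp
    ultimately show ?thesis by simp
  qed
  obtain l \<zeta> where \<zeta>: "t1 < \<zeta>" "\<zeta> < t2" "(\<theta> has_real_derivative l) (at \<zeta>)"
    "\<theta> t2 - \<theta> t1 = (t2 - t1) * l"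
    using MVT[OF t(1) c\<theta>] by (metis d\<theta> real_differentiable_def)
  have "l = sqrt (a * (e3 - u \<zeta>))"
    using DERIV_unique[OF \<zeta>(3) d\<theta>[OF \<zeta>(1,2)]] .
  then have "sqrt (a * (e3 - e2)) \<le> l"
    using range[of \<zeta>] a by (auto intro: mult_left_mono)
  then have "sqrt (a * (e3 - e2)) * (t2 - t1) \<le> l * (t2 - t1)"
    using t by (intro mult_right_mono) auto
  also have "\<dots> = \<theta> t2 - \<theta> t1" using \<zeta>(4) by simp
  also have "(u t2 - m) / r = 1" "(u t1 - m) / r = - 1"
    using t r by (auto simp: m_def r_def field_simps)
  then have "\<theta> t2 - \<theta> t1 = pi" by (simp add: \<theta>_def)
  finally show ?thesis .
qed

text \<open>Composing the reflections at the two ends of a rising arc gives the translation by twice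
  its duration. This is a period of \<open>u\<close>, so \<open>T\<close> cannot exceed it.\<close>

lemma minimal_period_bound:
  assumes T: "minimal_period u T" and attained: "u p = e1" "u q = e2"
  shows "sqrt (a * (e3 - e2)) * T \<le> 2 * pi"
proof -
  have T0: "T > 0" and "\<And>t. u (t + T) = u t" using T by (auto simp: minimal_period_def)
  then interpret periodic_fun_simple u T by unfold_locales
  \<comment> \<open>Shifting the maximum by whole periods places it after the minimum at
    \<open>p\<close>.\<close>
  obtain n :: nat where "p - q < real n * T"
    using reals_Archimedean3[OF T0] by blast
  then have n: "p < q + real n * T" by simp
  define b where "b = q + real n * T"
  have ub: "u b = e2" unfolding b_def plus_of_nat by (rule attained)
  have comp: "compact {t \<in> {c..d}. u t = e}" for c d e
    using continuous_closed_preimage_constant[OF continuous_u(1), of "{c..d}" e]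
    by (intro compact_eq_bounded_closed[THEN iffD2]) (auto intro: bounded_subset[OF bounded_closed_interval])
  \<comment> \<open>Taking the last minimum before \<open>b\<close> and then the first maximum after
    it ensures that \<open>u\<close> stays strictly between \<open>e1\<close> and \<open>e2\<close>
    in the interior.\<close>
  obtain t1 where t1: "t1 \<in> {t \<in> {p..b}. u t = e1}" "\<forall>t\<in>{t \<in> {p..b}. u t = e1}. t \<le> t1"
    using compact_attains_sup[OF comp[of p b e1]] attained n by (force simp: b_def)
  have "b \<in> {t \<in> {t1..b}. u t = e2}" using t1 ub by simp
  then obtain t2 where t2: "t2 \<in> {t \<in> {t1..b}. u t = e2}" "\<forall>t\<in>{t \<in> {t1..b}. u t = e2}. t2 \<le> t"
    using compact_attains_inf[OF comp[of t1 b e2]] by blast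
  have ut: "u t1 = e1" "u t2 = e2" using t1 t2 by auto
  then have lt: "t1 < t2" using t2 e by (metis (mono_tags, lifting) atLeastAtMost_iff le_less less_irrefl mem_Collect_eq)
  have len: "sqrt (a * (e3 - e2)) * (t2 - t1) \<le> pi"
  proof (rule rising_arc_length[OF lt ut])
    fix t assume t: "t1 < t" "t < t2"
    have "p \<le> t" "t \<le> b" "t1 \<le> t" using t1(1) t2(1) t by auto
    then have "u t = e1 \<Longrightarrow> t \<le> t1" "u t = e2 \<Longrightarrow> t2 \<le> t"
      using t1(2) t2 by auto
    then have "u t \<noteq> e1" "u t \<noteq> e2" using t by auto
    then show "e1 < u t \<and> u t < e2" using range[of t] by auto
  qed
  have crit: "u' t1 = 0" "u' t2 = 0" using energy[of t1] energy[of t2] ut by auto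
  have "u (t + 2 * (t2 - t1)) = u t" for t
  proof -
    have "u (t + 2 * (t2 - t1)) = u (2 * t2 - (2 * t1 - t))" by (simp add: algebra_simps)
    also have "\<dots> = u (2 * t1 - t)" by (rule reflection[OF crit(2)])
    also have "\<dots> = u t" by (rule reflection[OF crit(1)])
    finally show ?thesis .
  qed
  then have "T \<le> 2 * (t2 - t1)"
    using T lt unfolding minimal_period_def by (metis diff_gt_0_iff_gt not_le zero_less_mult_iff zero_less_numeral)
  then have "sqrt (a * (e3 - e2)) * T \<le> sqrt (a * (e3 - e2)) * (2 * (t2 - t1))"
    using a e by (intro mult_left_mono) auto
  also have "\<dots> = 2 * (sqrt (a * (e3 - e2)) * (t2 - t1))" by simp
  finally show ?thesis using len by linarith
qed

end

section \<open>Regularity and conserved quantities of the curves\<close>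

lemma has_weak_derivative_inner:
  fixes f g :: "real \<Rightarrow> 'a::euclidean_space"
  assumes "has_weak_derivative f g"
  shows "has_weak_derivative (\<lambda>t. f t \<bullet> b) (\<lambda>t. g t \<bullet> b)"
  unfolding has_weak_derivative_altdef
proof (intro conjI allI impI)
  note D = has_weak_derivativeD[OF assms]
  show "integrable circle (\<lambda>t. f t \<bullet> b)" "integrable circle (\<lambda>t. g t \<bullet> b)"
    using D by auto
  fix \<phi> \<phi>' assume C: "C1_periodic \<phi> \<phi>'"
  have "(\<integral>t. (\<phi>' t *\<^sub>R f t) \<bullet> b \<partial>circle) = - (\<integral>t. (\<phi> t *\<^sub>R g t) \<bullet> b \<partial>circle)"
    using integrable_circle_mult[OF C1_periodicD(3)[OF C] D(1)]
      integrable_circle_mult[OF C1_periodicD(4)[OF C] D(2)] D(3)[OF C]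
    by (subst (1 2) integral_inner_left) auto
  then show "(\<integral>t. \<phi>' t *\<^sub>R (f t \<bullet> b) \<partial>circle) = - (\<integral>t. \<phi> t *\<^sub>R (g t \<bullet> b) \<partial>circle)"
    by simp
qed

lemma has_weak_derivative_sum:
  fixes f g :: "'i \<Rightarrow> real \<Rightarrow> 'a::euclidean_space"
  assumes "finite I" "\<And>i. i \<in> I \<Longrightarrow> has_weak_derivative (f i) (g i)"
  shows "has_weak_derivative (\<lambda>t. \<Sum>i\<in>I. f i t) (\<lambda>t. \<Sum>i\<in>I. g i t)"
  using assms
proof (induction I rule: finite_induct)
  case empty
  show ?case by (simp add: has_weak_derivative_def)
next
  case (insert i I)
  then show ?case by (simp add: has_weak_derivative_add)
qed

text \<open>The product of a test function with \<open>f\<close> is again a test function; using it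
  in the weak formulation for \<open>g\<close> yields the rule.\<close>

lemma has_weak_derivative_scaleR:
  fixes g h :: "real \<Rightarrow> 'a::euclidean_space"
  assumes f: "C1_periodic f f'" and gh: "has_weak_derivative g h"
  shows "has_weak_derivative (\<lambda>t. f t *\<^sub>R g t) (\<lambda>t. f' t *\<^sub>R g t + f t *\<^sub>R h t)"
  unfolding has_weak_derivative_altdef
proof (intro conjI allI impI)
  note D = has_weak_derivativeD[OF gh]
  note F = C1_periodicD[OF f]
  note i = integrable_circle_mult[OF F(4) D(1)] integrable_circle_mult[OF F(4) D(2)]
    integrable_circle_mult[OF F(3) D(1)]
  show "integrable circle (\<lambda>t. f t *\<^sub>R g t)" "integrable circle (\<lambda>t. f' t *\<^sub>R g t + f t *\<^sub>R h t)"
    using i by auto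
  fix \<phi> \<phi>' assume C: "C1_periodic \<phi> \<phi>'"
  note P = C1_periodicD[OF C]
  have "C1_periodic (\<lambda>t. \<phi> t * f t) (\<lambda>t. \<phi>' t * f t + \<phi> t * f' t)"
  proof (rule C1_periodicI)
    show "periodic_2pi (\<lambda>t. \<phi> t * f t)" using F(1) P(1) by (simp add: periodic_2pi_def)
    show "((\<lambda>t. \<phi> t * f t) has_real_derivative \<phi>' t * f t + \<phi> t * f' t) (at t)" for t
      using DERIV_mult[OF P(2) F(2), of t] by (simp add: algebra_simps)
    show "continuous_on UNIV (\<lambda>t. \<phi>' t * f t + \<phi> t * f' t)"
      using F P by (intro continuous_intros)
  qed
  from D(3)[OF this]
  have "(\<integral>t. \<phi>' t *\<^sub>R f t *\<^sub>R g t + \<phi> t *\<^sub>R f' t *\<^sub>R g t \<partial>circle) = - (\<integral>t. \<phi> t *\<^sub>R f t *\<^sub>R h t \<partial>circle)"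
    by (simp add: scaleR_add_left)
  then show "(\<integral>t. \<phi>' t *\<^sub>R f t *\<^sub>R g t \<partial>circle) = - (\<integral>t. \<phi> t *\<^sub>R (f' t *\<^sub>R g t + f t *\<^sub>R h t) \<partial>circle)"
    using integrable_circle_mult[OF P(3) i(1)] integrable_circle_mult[OF P(4) i(2)]
      integrable_circle_mult[OF P(4) i(3)]
    by (simp add: scaleR_add_right Bochner_Integration.integral_add del: scaleR_scaleR)
      (simp add: eq_neg_iff_add_eq_0 algebra_simps del: scaleR_scaleR)
qed

text \<open>Expansion in the standard basis reduces this to the rule with a scalar factor.\<close>

lemma has_weak_derivative_inner_product:
  fixes f f' g h :: "real \<Rightarrow> 'a::euclidean_space"
  assumes f: "periodic_2pi f" "\<And>t. (f has_vector_derivative f' t) (at t)" "continuous_on UNIV f'"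
    and gh: "has_weak_derivative g h"
  shows "has_weak_derivative (\<lambda>t. f t \<bullet> g t) (\<lambda>t. f' t \<bullet> g t + f t \<bullet> h t)"
proof -
  have "has_weak_derivative (\<lambda>t. \<Sum>b\<in>Basis. (f t \<bullet> b) *\<^sub>R (g t \<bullet> b))
      (\<lambda>t. \<Sum>b\<in>Basis. (f' t \<bullet> b) *\<^sub>R (g t \<bullet> b) + (f t \<bullet> b) *\<^sub>R (h t \<bullet> b))"
  proof (intro has_weak_derivative_sum has_weak_derivative_scaleR has_weak_derivative_inner gh)
    fix b :: 'a
    show "C1_periodic (\<lambda>t. f t \<bullet> b) (\<lambda>t. f' t \<bullet> b)"
    proof (rule C1_periodicI)
      show "periodic_2pi (\<lambda>t. f t \<bullet> b)" using f(1) by (simp add: periodic_2pi_def)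
      show "((\<lambda>t. f t \<bullet> b) has_real_derivative f' t \<bullet> b) (at t)" for t
        using bounded_linear.has_vector_derivative[OF bounded_linear_inner_left f(2)]
        by (simp add: has_real_derivative_iff_has_vector_derivative)
      show "continuous_on UNIV (\<lambda>t. f' t \<bullet> b)" using f(3) by (intro continuous_intros)
    qed
  qed simp
  then show ?thesis
    by (simp add: sum.distrib flip: euclidean_inner)
qed

section \<open>Classical regularity of the solutions\<close>

text \<open>The first weak derivative is itself weakly differentiable and thus has a continuous
  representative \<open>V\<close>, which is then a classical derivative. At this stage
  \<open>V\<close> is differentiable only weakly.\<close>

lemma H2_circle_C1:
  fixes u :: "real \<Rightarrow> 'a::euclidean_space"
  assumes "u \<in> H2_circle"
  obtains V w where "continuous_on UNIV V" "periodic_2pi V" "\<And>t. (u has_vector_derivative V t) (at t)"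
    "has_weak_derivative V w"
proof -
  obtain v w where u: "periodic_2pi u" "continuous_on UNIV u"
    and vw: "has_weak_derivative u v" "has_weak_derivative v w"
    using assms unfolding H2_circle_def by blast
  obtain V where V: "continuous_on UNIV V" "periodic_2pi V" "AE t in circle. v t = V t"
    by (rule weakly_differentiable_continuous_representative[OF vw(2)])
  have i: "integrable circle V"
    using V(1) by (intro integrable_circle_continuous) (auto intro: continuous_on_subset)
  have iu: "integrable circle u" and iw: "integrable circle w"
    using has_weak_derivativeD[OF vw(1)] has_weak_derivativeD[OF vw(2)] by auto
  have "has_weak_derivative u V"
    by (rule has_weak_derivative_cong_AE[OF vw(1) iu _ i V(3)]) simp
  then have "(u has_vector_derivative V t) (at t)" for t
    by (rule weak_imp_classical_derivative) (use u V in auto)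
  moreover have "has_weak_derivative V w"
    by (rule has_weak_derivative_cong_AE[OF vw(2) i V(3) iw]) simp
  ultimately show ?thesis using V that by blast
qed

definition x0' :: "real \<Rightarrow> real \<Rightarrow> real^3" where
  "x0' R t = vector [- R * sin t, R * cos t, 0]"

lemma has_vector_derivative_vector_3:
  assumes "(f has_real_derivative f') (at t)" "(g has_real_derivative g') (at t)"
    "(h has_real_derivative h') (at t)"
  shows "((\<lambda>t. vector [f t, g t, h t] :: real^3) has_vector_derivative vector [f', g', h']) (at t)"
proof -
  have eq: "vector [a, b, c] = a *\<^sub>R axis 1 1 + b *\<^sub>R axis 2 1 + c *\<^sub>R (axis 3 1 :: real^3)" for a b c :: real
    by (simp add: vec_eq_iff forall_3 axis_def)
  show ?thesis
    unfolding eq using assms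
    by (auto intro!: derivative_eq_intros)
qed

lemma x0_derivatives:
  "(x0 R has_vector_derivative x0' R t) (at t)"
  "(x0' R has_vector_derivative - x0 R t) (at t)"
proof -
  have "- x0 R t = vector [- R * cos t, - R * sin t, 0]"
    by (simp add: x0_def vec_eq_iff forall_3)
  moreover have "x0 R = (\<lambda>t. vector [R * cos t, R * sin t, 0])" "x0' R = (\<lambda>t. vector [- R * sin t, R * cos t, 0])"
    by (auto simp: x0_def x0'_def)
  ultimately show "(x0 R has_vector_derivative x0' R t) (at t)"
    "(x0' R has_vector_derivative - x0 R t) (at t)"
    by (auto simp only: intro!: has_vector_derivative_vector_3 derivative_eq_intros) auto
qed

lemma x0_periodic: "periodic_2pi (x0 R)" "periodic_2pi (x0' R)"
  by (simp_all add: periodic_2pi_def x0_def x0'_def)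

lemma continuous_on_has_vector_derivative:
  fixes f :: "real \<Rightarrow> 'a::real_normed_vector"
  shows "(\<And>t. (f has_vector_derivative f' t) (at t)) \<Longrightarrow> continuous_on UNIV f"
  by (meson continuous_on_eq_continuous_at has_vector_derivative_continuous open_UNIV)

lemma x0_weak_derivatives:
  "has_weak_derivative (x0 R) (x0' R)" "has_weak_derivative (x0' R) (\<lambda>t. - x0 R t)"
  using has_weak_derivative_classical[OF x0_periodic(1) x0_derivatives(1)]
    has_weak_derivative_classical[OF x0_periodic(2) x0_derivatives(2)]
    continuous_on_has_vector_derivative[OF x0_derivatives(1)]
    continuous_on_has_vector_derivative[OF x0_derivatives(2)]
  by (auto intro: continuous_on_minus)

lemma x0_norm:
  assumes "R > 0" shows "norm (x0 R t) = R" "norm (x0' R t) = R"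
proof -
  have "(R * cos t)\<^sup>2 + (R * sin t)\<^sup>2 = R\<^sup>2"
    using sin_cos_squared_add2[of t] by (simp add: power_mult_distrib flip: distrib_left)
  then show "norm (x0 R t) = R" "norm (x0' R t) = R"
    using assms by (simp_all add: norm_vec_def L2_set_def sum_3 x0_def x0'_def add.commute)
qed

text \<open>Solving the equation for the second derivative: take the cross product with \<open>p\<close>, use
  Lagrange's formula, and substitute \<open>p \<bullet> p = R\<^sup>2\<close> and \<open>p \<bullet> p'' = - (p' \<bullet> p')\<close>.\<close>

definition accel :: "real \<Rightarrow> real \<Rightarrow> real^3 \<Rightarrow> real^3 \<Rightarrow> real^3" where
  "accel R lam p v = (1 / R\<^sup>2) *\<^sub>R ((lam * p $ 3 - v \<bullet> v) *\<^sub>R p - (lam * R\<^sup>2) *\<^sub>R axis 3 1 + lam *\<^sub>R cross3 p v)"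

lemma accel_unique:
  assumes R: "R > 0" and p: "p \<bullet> p = R\<^sup>2" and w: "p \<bullet> w = - (v \<bullet> v)"
    and eq: "cross3 p w - lam *\<^sub>R cross3 (axis 3 1) p + lam *\<^sub>R v = 0"
  shows "w = accel R lam p v"
proof -
  have "cross3 p w = lam *\<^sub>R cross3 (axis 3 1) p - lam *\<^sub>R v"
    using eq by (simp add: algebra_simps)
  then have "cross3 p (cross3 p w) = lam *\<^sub>R cross3 p (cross3 (axis 3 1) p) - lam *\<^sub>R cross3 p v"
    by (simp add: cross_mult_right cross_minus_right Cross3.right_diff_distrib)
  then have "(p \<bullet> w) *\<^sub>R p - (p \<bullet> p) *\<^sub>R w = lam *\<^sub>R ((p \<bullet> p) *\<^sub>R axis 3 1 - (p \<bullet> axis 3 1) *\<^sub>R p) - lam *\<^sub>R cross3 p v"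
    unfolding Lagrange .
  then have "R\<^sup>2 *\<^sub>R w = (lam * p $ 3 - v \<bullet> v) *\<^sub>R p - (lam * R\<^sup>2) *\<^sub>R axis 3 1 + lam *\<^sub>R cross3 p v"
    by (simp add: p w inner_axis algebra_simps)
  then show ?thesis
    using R by (simp add: accel_def flip: \<open>R\<^sup>2 *\<^sub>R w = _\<close>)
qed

text \<open>The converse of \<open>accel_unique\<close> for tangential \<open>v\<close>: the solved
  form gives back the original equation. Its third component yields the conservation of
  \<open>C_fun\<close>.\<close>

lemma cross3_accel:
  assumes R: "R > 0" and p: "p \<bullet> p = R\<^sup>2" and v: "p \<bullet> v = 0"
  shows "cross3 p (accel R lam p v) = lam *\<^sub>R cross3 (axis 3 1) p - lam *\<^sub>R v"
proof -
  have "cross3 p (accel R lam p v) = (1 / R\<^sup>2) *\<^sub>R (- (lam * R\<^sup>2) *\<^sub>R cross3 p (axis 3 1) + lam *\<^sub>R cross3 p (cross3 p v))"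
    by (simp add: accel_def cross_mult_right cross_add_right Cross3.right_diff_distrib)
  also have "cross3 p (cross3 p v) = - R\<^sup>2 *\<^sub>R v"
    unfolding Lagrange by (simp add: p v)
  also have "cross3 p (axis 3 1) = - cross3 (axis 3 1) p"
    by (rule cross_skew)
  finally show ?thesis using R by (simp add: algebra_simps)
qed

text \<open>The radial and the cross-product term of \<open>accel\<close> are orthogonal to
  \<open>v\<close>; only the vertical force does work.\<close>

lemma inner_accel:
  assumes R: "R > 0" and v: "p \<bullet> v = 0"
  shows "v \<bullet> accel R lam p v = - lam * v $ 3"
  using R v by (simp add: accel_def inner_add_right inner_diff_right inner_axis dot_cross_self inner_commute)

lemma continuous_on_accel:
  assumes "continuous_on A p" "continuous_on A v"
  shows "continuous_on A (\<lambda>t. accel R lam (p t) (v t))"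
  unfolding accel_def using assms
  by (intro continuous_intros
      bounded_bilinear.continuous_on[OF bilinear_cross[unfolded bilinear_conv_bounded_bilinear]])

text \<open>Bootstrapping: the weak second derivative equals \<open>accel R lam (x t) (X t)\<close>
  almost everywhere, and this expression is continuous and periodic, so \<open>X\<close> is
  classically differentiable.\<close>

lemma Zset_classical:
  assumes R: "R > 0" and Z: "(lam, u) \<in> Zset R"
  defines "x \<equiv> curve R u"
  obtains X where "periodic_2pi x" "periodic_2pi X"
    "\<And>t. (x has_vector_derivative X t) (at t)"
    "\<And>t. (X has_vector_derivative accel R lam (x t) (X t)) (at t)"
    "\<And>t. x t \<bullet> x t = R\<^sup>2" "\<And>t. x t \<bullet> X t = 0"
proof -
  have H: "u \<in> H2_circle" and sol: "is_solution lam x" and nrm: "norm (x t) = R" for t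
    using Z by (auto simp: Zset_def x_def)
  have up: "periodic_2pi u" using H by (simp add: H2_circle_def)
  obtain V w where V: "continuous_on UNIV V" "periodic_2pi V" "\<And>t. (u has_vector_derivative V t) (at t)"
    "has_weak_derivative V w"
    using H2_circle_C1[OF H] by blast
  define X where "X t = x0' R t + V t" for t
  define W where "W t = - x0 R t + w t" for t
  have x_eq: "x = (\<lambda>t. x0 R t + u t)" by (simp add: x_def curve_def)
  have px: "periodic_2pi x" and pX: "periodic_2pi X"
    using x0_periodic[of R] up V(2) by (simp_all add: periodic_2pi_def x_eq X_def)
  have dx: "(x has_vector_derivative X t) (at t)" for t
    unfolding x_eq X_def by (intro has_vector_derivative_add x0_derivatives V)
  have cx: "continuous_on UNIV x" by (rule continuous_on_has_vector_derivative[OF dx])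
  have cX: "continuous_on UNIV X"
    unfolding X_def by (intro continuous_intros V continuous_on_has_vector_derivative[OF x0_derivatives(2)])
  have XW: "has_weak_derivative X W"
    using has_weak_derivative_add[OF x0_weak_derivatives(2) V(4)]
    by (simp add: X_def[abs_def] W_def[abs_def])
  have xX: "has_weak_derivative x X"
    by (rule has_weak_derivative_classical[OF px dx cX])
  have xx: "x t \<bullet> x t = R\<^sup>2" for t
    using nrm[of t] by (simp add: dot_square_norm)
  have xdotX: "x t \<bullet> X t = 0" for t
  proof -
    have "((\<lambda>t. x t \<bullet> x t) has_vector_derivative x t \<bullet> X t + X t \<bullet> x t) (at t)"
      by (rule bounded_bilinear.has_vector_derivative[OF bounded_bilinear_inner dx dx])
    then have "((\<lambda>t. R\<^sup>2) has_vector_derivative 2 * (x t \<bullet> X t)) (at t)"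
      by (simp add: xx inner_commute)
    from vector_derivative_unique_at[OF this has_vector_derivative_const] show ?thesis by simp
  qed
  \<comment> \<open>\<open>X\<close> is not yet known to be differentiable, so \<open>x \<bullet> X = 0\<close> is differentiated weakly.\<close>
  have "has_weak_derivative (\<lambda>t. 0) (\<lambda>t. X t \<bullet> X t + x t \<bullet> W t)"
    using has_weak_derivative_inner_product[OF px dx cX XW] by (simp add: xdotX)
  moreover have "has_weak_derivative (\<lambda>t. 0) (\<lambda>t. 0 :: real)"
    by (simp add: has_weak_derivative_def)
  ultimately have "AE t in circle. X t \<bullet> X t + x t \<bullet> W t = 0"
    by (rule has_weak_derivative_unique)
  moreover have "AE t in circle. wderiv x t = X t" by (rule AE_wderiv_eq[OF xX])
  moreover have "AE t in circle. wderiv (wderiv x) t = W t"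
    by (rule AE_wderiv_eq[OF has_weak_derivative_of_wderiv[OF xX XW]])
  moreover note sol[unfolded is_solution_def]
  ultimately have ae: "AE t in circle. W t = accel R lam (x t) (X t)"
  proof eventually_elim
    case (elim t)
    then show ?case by (intro accel_unique[OF R xx]) auto
  qed
  have cA: "continuous_on UNIV (\<lambda>t. accel R lam (x t) (X t))"
    by (rule continuous_on_accel[OF cx cX])
  have XA: "has_weak_derivative X (\<lambda>t. accel R lam (x t) (X t))"
  proof (rule has_weak_derivative_cong_AE[OF XW _ _ _ ae])
    show "integrable circle (\<lambda>t. accel R lam (x t) (X t))"
      using cA by (intro integrable_circle_continuous) (auto intro: continuous_on_subset)
  qed (use has_weak_derivativeD(1)[OF XW] in auto)
  have pA: "periodic_2pi (\<lambda>t. accel R lam (x t) (X t))"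
    using px pX by (simp add: periodic_2pi_def)
  show ?thesis
    by (rule that[OF px pX dx weak_imp_classical_derivative[OF XA cX pX cA pA] xx xdotX])
qed

section \<open>Conserved quantities and the vertical motion\<close>

lemma cross3_component_3: "cross3 p v $ 3 = p $ 1 * v $ 2 - p $ 2 * v $ 1"
  by (simp add: cross3_def)

lemma has_real_derivative_nth:
  fixes f :: "real \<Rightarrow> real^3"
  assumes "(f has_vector_derivative f') (at t)"
  shows "((\<lambda>t. f t $ i) has_real_derivative f' $ i) (at t)"
  using bounded_linear.has_vector_derivative[OF bounded_linear_vec_nth assms]
  by (simp add: has_real_derivative_iff_has_vector_derivative)

text \<open>This is the identity \<open>\<bar>e \<times> (p \<times> v)\<bar>\<^sup>2 = \<bar>p \<times> v\<bar>\<^sup>2 - ((p \<times> v) \<bullet> e)\<^sup>2\<close> for the vertical unit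
  vector \<open>e\<close>, expanded with Lagrange's identities.\<close>

lemma orthogonal_vertical_identity:
  fixes p v :: "real^3"
  assumes "p \<bullet> p = R\<^sup>2" "p \<bullet> v = 0"
  shows "R\<^sup>2 * (v $ 3)\<^sup>2 = (R\<^sup>2 - (p $ 3)\<^sup>2) * (v \<bullet> v) - (cross3 p v $ 3)\<^sup>2"
proof -
  have p: "R\<^sup>2 = (p $ 1)\<^sup>2 + (p $ 2)\<^sup>2 + (p $ 3)\<^sup>2"
    using assms(1) by (simp add: inner_vec_def sum_3 power2_eq_square)
  have v: "v \<bullet> v = (v $ 1)\<^sup>2 + (v $ 2)\<^sup>2 + (v $ 3)\<^sup>2"
    by (simp add: inner_vec_def sum_3 power2_eq_square)
  have o: "p $ 1 * v $ 1 + p $ 2 * v $ 2 + p $ 3 * v $ 3 = 0"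
    using assms(2) by (simp add: inner_vec_def sum_3)
  show ?thesis unfolding p v cross3_component_3 using o by algebra
qed

lemma constant_if_derivative_0:
  fixes f :: "real \<Rightarrow> real"
  assumes "\<And>t. (f has_real_derivative 0) (at t)"
  shows "f t = f 0"
  by (rule DERIV_isconst_all) (use assms in blast)

locale sphere_solution =
  fixes R lam :: real and x X :: "real \<Rightarrow> real^3"
  assumes R: "R > 0" and lam: "lam > 0"
    and px: "periodic_2pi x" and pX: "periodic_2pi X"
    and dx: "\<And>t. (x has_vector_derivative X t) (at t)"
    and dX: "\<And>t. (X has_vector_derivative accel R lam (x t) (X t)) (at t)"
    and xx: "\<And>t. x t \<bullet> x t = R\<^sup>2" and xX: "\<And>t. x t \<bullet> X t = 0"
begin

text \<open>The mechanical energy, half the squared speed plus \<open>lam\<close> times the height: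
  the third component of \<open>cross3 x x'\<close> enters \<open>C_const\<close> and
  \<open>E_const / lam\<close> with opposite signs and cancels.\<close>

definition k where "k = C_const lam x + E_const lam x / lam"

abbreviation "C \<equiv> C_const lam x"

text \<open>The derivative of \<open>cross3 x X\<close> is \<open>cross3 x X'\<close>, and in the
  third component of the equation the term with \<open>axis 3 1\<close> vanishes, leaving
  \<open>- lam * X t $ 3\<close>.\<close>

lemma C_eq: "cross3 (x t) (X t) $ 3 = C - lam * x t $ 3"
proof -
  have vd: "vector_derivative x (at t) = X t" for t
    using dx by (rule vector_derivative_at)
  have "(\<lambda>t. cross3 (x t) (X t) $ 3 + lam * x t $ 3) t = (\<lambda>t. cross3 (x t) (X t) $ 3 + lam * x t $ 3) 0"
  proof (rule constant_if_derivative_0)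
    fix t
    have "cross3 (x t) (accel R lam (x t) (X t)) $ 3 = - lam * X t $ 3"
      unfolding cross3_accel[OF R xx xX] by (simp add: cross3_component_3 axis_def)
    then show "((\<lambda>t. cross3 (x t) (X t) $ 3 + lam * x t $ 3) has_real_derivative 0) (at t)"
      unfolding cross3_component_3
      by (auto intro!: derivative_eq_intros has_real_derivative_nth dx dX simp: algebra_simps)
  qed
  then show ?thesis by (simp add: C_const_def C_fun_def vd)
qed

lemma speed_eq: "X t \<bullet> X t = 2 * (k - lam * x t $ 3)"
proof -
  have vd: "vector_derivative x (at t) = X t" for t
    using dx by (rule vector_derivative_at)
  have "(\<lambda>t. X t \<bullet> X t / 2 + lam * x t $ 3) t = (\<lambda>t. X t \<bullet> X t / 2 + lam * x t $ 3) 0"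
  proof (rule constant_if_derivative_0)
    fix t
    have "((\<lambda>t. X t \<bullet> X t) has_vector_derivative
        X t \<bullet> accel R lam (x t) (X t) + accel R lam (x t) (X t) \<bullet> X t) (at t)"
      by (rule bounded_bilinear.has_vector_derivative[OF bounded_bilinear_inner dX dX])
    then have "((\<lambda>t. X t \<bullet> X t) has_real_derivative - 2 * lam * X t $ 3) (at t)"
      using inner_accel[OF R xX[of t]]
      by (simp add: has_real_derivative_iff_has_vector_derivative inner_commute mult.assoc)
    then show "((\<lambda>t. X t \<bullet> X t / 2 + lam * x t $ 3) has_real_derivative 0) (at t)"
      by (auto intro!: derivative_eq_intros has_real_derivative_nth dx)
  qed
  moreover have "k = X 0 \<bullet> X 0 / 2 + lam * x 0 $ 3"
    using lam by (simp add: k_def C_const_def C_fun_def E_const_def E_fun_def Let_def vd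
        cross3_component_3 dot_square_norm field_simps)
  ultimately show ?thesis by simp
qed

lemma vertical_poly_eq:
  "vertical_poly R lam x s = 2 * lam / R\<^sup>2 * s ^ 3 - (2 * k + lam\<^sup>2) / R\<^sup>2 * s\<^sup>2
     + (2 * lam * C - 2 * lam * R\<^sup>2) / R\<^sup>2 * s + (2 * k * R\<^sup>2 - C\<^sup>2) / R\<^sup>2"
  using R lam
  by (simp add: vertical_poly_def Let_def k_def divide_simps power2_eq_square power3_eq_cube)
    (simp add: algebra_simps)

text \<open>The orthogonality identity expresses the vertical velocity through the speed and the
  vertical angular momentum, both of which are functions of the height by conservation.\<close>

lemma vertical_energy: "(X t $ 3)\<^sup>2 = vertical_poly R lam x (x t $ 3)"
proof -
  have "R\<^sup>2 * (X t $ 3)\<^sup>2 = (R\<^sup>2 - (x t $ 3)\<^sup>2) * (2 * (k - lam * x t $ 3)) - (C - lam * x t $ 3)\<^sup>2"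
    using orthogonal_vertical_identity[OF xx xX, of t] by (simp add: C_eq speed_eq)
  then show ?thesis
    unfolding vertical_poly_eq using R
    by (simp add: divide_simps power2_eq_square power3_eq_cube) (simp add: algebra_simps)
qed

text \<open>Half the derivative of the vertical polynomial.\<close>

definition vforce :: "real \<Rightarrow> real" where
  "vforce s = (3 * lam * s\<^sup>2 - (2 * k + lam\<^sup>2) * s + lam * (C - R\<^sup>2)) / R\<^sup>2"

text \<open>Read off from \<open>accel\<close> and the conserved quantities. Differentiating
  \<open>vertical_energy\<close> would give it only where the vertical velocity is nonzero.\<close>

lemma vertical_accel: "accel R lam (x t) (X t) $ 3 = vforce (x t $ 3)"
  by (simp add: accel_def vforce_def speed_eq C_eq axis_def power2_eq_square)
    (simp add: algebra_simps)

lemma vforce_lipschitz: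
  assumes "\<bar>s\<bar> \<le> R" "\<bar>t\<bar> \<le> R"
  shows "\<bar>vforce s - vforce t\<bar> \<le> (6 * lam * R + \<bar>2 * k + lam\<^sup>2\<bar>) / R\<^sup>2 * \<bar>s - t\<bar>"
proof -
  have "vforce s - vforce t = (3 * lam * (s + t) - (2 * k + lam\<^sup>2)) / R\<^sup>2 * (s - t)"
    by (simp add: vforce_def diff_divide_distrib[symmetric] power2_eq_square algebra_simps)
  then have "\<bar>vforce s - vforce t\<bar> = \<bar>3 * lam * (s + t) - (2 * k + lam\<^sup>2)\<bar> / R\<^sup>2 * \<bar>s - t\<bar>"
    by (simp add: abs_mult)
  moreover have "\<bar>3 * lam * (s + t) - (2 * k + lam\<^sup>2)\<bar> \<le> 6 * lam * R + \<bar>2 * k + lam\<^sup>2\<bar>"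
  proof -
    have "\<bar>3 * lam * (s + t)\<bar> \<le> 3 * lam * (2 * R)"
      using assms lam by (auto simp: abs_mult intro!: mult_left_mono)
    then show ?thesis by linarith
  qed
  ultimately show ?thesis
    using R by (simp add: mult_right_mono divide_right_mono)
qed

text \<open>Vieta's relation for the quadratic coefficient, isolated by the second difference at -1,
  0, 1, which removes the odd powers and the constant term.\<close>

lemma root_sum:
  assumes "\<And>s. vertical_poly R lam x s = 2 * lam / R\<^sup>2 * (s - e1) * (s - e2) * (s - e3)"
  shows "2 * k + lam\<^sup>2 = 2 * lam * (e1 + e2 + e3)"
proof -
  let ?P = "vertical_poly R lam x"
  have 1: "?P 1 + ?P (- 1) - 2 * ?P 0 = - 2 * ((2 * k + lam\<^sup>2) / R\<^sup>2)"
    unfolding vertical_poly_eq using R by (simp add: field_simps)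
  have 2: "?P 1 + ?P (- 1) - 2 * ?P 0 = - 2 * (2 * lam * (e1 + e2 + e3) / R\<^sup>2)"
    unfolding assms by (simp add: algebra_simps add_divide_distrib diff_divide_distrib)
  show ?thesis
    using trans[OF sym[OF 1] 2] R by (simp only: mult_cancel_left divide_cancel_right) simp
qed

text \<open>The period bound keeps \<open>lam * e3\<close>, and hence the speed, under control although \<open>e3\<close> itself may
  be unbounded as \<open>lam\<close> tends to 0.\<close>

lemma speed_bound:
  assumes e: "- R < e1" "e1 < e2" "e2 < R" "e2 < e3"
    and roots: "\<And>s. vertical_poly R lam x s = 2 * lam / R\<^sup>2 * (s - e1) * (s - e2) * (s - e3)"
    and range: "is_min_value (\<lambda>t. x t $ 3) e1" "is_max_value (\<lambda>t. x t $ 3) e2"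
    and q: "q > 0" "minimal_period (\<lambda>t. x t $ 3) (2 * pi / real q)"
  shows "X t \<bullet> X t \<le> 4 * lam * R + (real q * R)\<^sup>2"
proof -
  have bnd: "e1 \<le> x t $ 3" "x t $ 3 \<le> e2" for t
    using range by (auto simp: is_min_value_def is_max_value_def)
  obtain p r where pr: "x p $ 3 = e1" "x r $ 3 = e2"
    using range by (auto simp: is_min_value_def is_max_value_def image_iff)
  interpret cubic_oscillation "\<lambda>t. x t $ 3" "\<lambda>t. X t $ 3" vforce "2 * lam / R\<^sup>2" e1 e2 e3
    "(6 * lam * R + \<bar>2 * k + lam\<^sup>2\<bar>) / R\<^sup>2"
  proof
    show "((\<lambda>t. X t $ 3) has_real_derivative vforce (x t $ 3)) (at t)" for t
      using has_real_derivative_nth[OF dX, where i = 3] unfolding vertical_accel .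
    show "\<bar>vforce (x s $ 3) - vforce (x t $ 3)\<bar>
        \<le> (6 * lam * R + \<bar>2 * k + lam\<^sup>2\<bar>) / R\<^sup>2 * \<bar>x s $ 3 - x t $ 3\<bar>" for s t
      using bnd[of s] bnd[of t] e by (intro vforce_lipschitz) auto
    show "(X t $ 3)\<^sup>2 = 2 * lam / R\<^sup>2 * (x t $ 3 - e1) * (x t $ 3 - e2) * (x t $ 3 - e3)" for t
      unfolding vertical_energy roots ..
  qed (use R lam e bnd has_real_derivative_nth[OF dx] in auto)
  have "sqrt (2 * lam / R\<^sup>2 * (e3 - e2)) * (2 * pi / real q) \<le> 2 * pi"
    by (rule minimal_period_bound[OF q(2) pr])
  then have "sqrt (2 * lam / R\<^sup>2 * (e3 - e2)) \<le> real q"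
    using q(1) by (simp add: field_simps)
  then have "2 * lam / R\<^sup>2 * (e3 - e2) \<le> (real q)\<^sup>2"
    using sqrt_le_D by blast
  then have 1: "2 * lam * (e3 - e2) \<le> (real q * R)\<^sup>2"
    using R by (simp add: field_simps power_mult_distrib)
  have "X t \<bullet> X t = 2 * k - 2 * lam * x t $ 3" by (simp add: speed_eq)
  also from root_sum[OF roots] have "\<dots> = 2 * lam * (e1 + e2 + e3) - lam\<^sup>2 - 2 * lam * x t $ 3"
    by simp
  \<comment> \<open>The speed is largest at the lowest height \<open>e1\<close>; the term
    \<open>lam\<^sup>2\<close> is dropped.\<close>
  also have "\<dots> \<le> 2 * lam * (e1 + e2 + e3) - 2 * lam * e1"
  proof -
    have "2 * lam * e1 \<le> 2 * lam * x t $ 3" using bnd(1)[of t] lam by simp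
    then show ?thesis using zero_le_power2[of lam] by linarith
  qed
  \<comment> \<open>The split separates a part bounded by the radius from the part controlled by the
    period.\<close>
  also have "\<dots> = 4 * lam * e2 + 2 * lam * (e3 - e2)" by (simp add: algebra_simps)
  also have "\<dots> \<le> 4 * lam * R + (real q * R)\<^sup>2"
    using 1 lam \<open>e2 < R\<close> by (intro add_mono mult_left_mono) auto
  finally show ?thesis .
qed

lemma norm_x: "norm (x t) = R"
  using xx[of t] R by (simp add: norm_eq_sqrt_inner)

lemma accel_bound:
  assumes "norm (X t) \<le> M" "lam \<le> \<Lambda>"
  shows "norm (accel R lam (x t) (X t)) \<le> (1 / R\<^sup>2) * ((\<Lambda> * R + M\<^sup>2) * R + \<Lambda> * R\<^sup>2 + \<Lambda> * (R * M))"
proof -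
  let ?v = "X t" and ?p = "x t"
  have M: "M \<ge> 0" using assms(1) norm_ge_zero order_trans by blast
  have X2: "?v \<bullet> ?v \<le> M\<^sup>2"
    using power_mono[OF assms(1) norm_ge_zero, of 2] by (simp add: dot_square_norm)
  have p3: "\<bar>?p $ 3\<bar> \<le> R" using component_le_norm_cart[of ?p 3] by (simp add: norm_x)
  have "\<bar>lam * ?p $ 3 - ?v \<bullet> ?v\<bar> \<le> \<Lambda> * R + M\<^sup>2"
  proof -
    have "\<bar>lam * ?p $ 3\<bar> \<le> \<Lambda> * R"
      unfolding abs_mult using assms(2) lam p3 R by (intro mult_mono) auto
    then show ?thesis using X2 inner_ge_zero[of ?v] by linarith
  qed
  then have n1: "norm ((lam * ?p $ 3 - ?v \<bullet> ?v) *\<^sub>R ?p) \<le> (\<Lambda> * R + M\<^sup>2) * R"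
    using R by (simp add: norm_x mult_right_mono)
  have n2: "norm ((lam * R\<^sup>2) *\<^sub>R (axis 3 1 :: real^3)) \<le> \<Lambda> * R\<^sup>2"
    using assms(2) lam by (simp add: abs_mult mult_right_mono)
  have "(norm (cross3 ?p ?v))\<^sup>2 \<le> (R * norm ?v)\<^sup>2"
    using norm_cross_dot[of ?p ?v] by (simp add: norm_x xX)
  then have "norm (cross3 ?p ?v) \<le> R * norm ?v"
    by (rule power2_le_imp_le) (use R in simp)
  also have "\<dots> \<le> R * M" using R assms(1) by simp
  finally have n3: "norm (lam *\<^sub>R cross3 ?p ?v) \<le> \<Lambda> * (R * M)"
    using lam assms(2) R M by (simp add: mult_mono)
  let ?a = "(lam * ?p $ 3 - ?v \<bullet> ?v) *\<^sub>R ?p" and ?b = "(lam * R\<^sup>2) *\<^sub>R (axis 3 1 :: real^3)"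
    and ?c = "lam *\<^sub>R cross3 ?p ?v"
  have "norm (?a - ?b + ?c) \<le> (\<Lambda> * R + M\<^sup>2) * R + \<Lambda> * R\<^sup>2 + \<Lambda> * (R * M)"
    using norm_triangle_ineq[of "?a - ?b" ?c] norm_triangle_ineq4[of ?a ?b] n1 n2 n3 by linarith
  then show ?thesis
    unfolding accel_def by (simp add: divide_right_mono)
qed

lemma continuous: "continuous_on A x" "continuous_on A X" "continuous_on A (\<lambda>t. accel R lam (x t) (X t))"
  using continuous_on_has_vector_derivative[OF dx] continuous_on_has_vector_derivative[OF dX]
  by (auto intro: continuous_on_subset continuous_on_accel)

lemma weak_derivatives:
  "has_weak_derivative x X" "has_weak_derivative X (\<lambda>t. accel R lam (x t) (X t))"
  using has_weak_derivative_classical[OF px dx continuous(2)]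
    has_weak_derivative_classical[OF pX dX continuous(3)] by auto

end

section \<open>Norm bounds and the final estimate\<close>

lemma Linf_norm_le:
  fixes f :: "real \<Rightarrow> 'a::euclidean_space"
  assumes "f \<in> borel_measurable circle" "AE t in circle. norm (f t) \<le> c"
  shows "Linf_norm f \<le> ereal c"
  unfolding Linf_norm_def using assms by (intro esssup_I) auto

text \<open>\<open>wderiv\<close> agrees with the given derivatives almost everywhere, which
  suffices for essential suprema.\<close>

lemma W2inf_norm_le:
  fixes x :: "real \<Rightarrow> 'a::euclidean_space"
  assumes w: "has_weak_derivative x X" "has_weak_derivative X Y"
    and b: "\<And>t. norm (x t) \<le> a" "\<And>t. norm (X t) \<le> b" "\<And>t. norm (Y t) \<le> c"
  shows "W2inf_norm x \<le> ereal (a + b + c)"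
proof -
  note D = has_weak_derivative_of_wderiv[OF w]
  have "Linf_norm x \<le> ereal a"
    using has_weak_derivativeD(1)[OF w(1)] b by (intro Linf_norm_le) auto
  moreover have "AE t in circle. norm (wderiv x t) \<le> b"
    using AE_wderiv_eq[OF w(1)] by eventually_elim (simp add: b)
  then have "Linf_norm (wderiv x) \<le> ereal b"
    using has_weak_derivativeD(1)[OF D] by (intro Linf_norm_le) auto
  moreover have "AE t in circle. norm (wderiv (wderiv x) t) \<le> c"
    using AE_wderiv_eq[OF D] by eventually_elim (simp add: b)
  then have "Linf_norm (wderiv (wderiv x)) \<le> ereal c"
    using has_weak_derivativeD(2)[OF has_weak_derivative_wderiv[OF D]] by (intro Linf_norm_le) auto
  ultimately show ?thesis
    unfolding W2inf_norm_def plus_ereal.simps(1)[symmetric] by (intro add_mono)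
qed

lemma H2_norm_le:
  fixes u :: "real \<Rightarrow> 'a::euclidean_space"
  assumes w: "has_weak_derivative u V" "has_weak_derivative V W"
    and b: "\<And>t. norm (u t) \<le> a" "\<And>t. norm (V t) \<le> b" "\<And>t. norm (W t) \<le> c"
  shows "H2_norm u \<le> sqrt (2 * pi * (a\<^sup>2 + b\<^sup>2 + c\<^sup>2))"
proof -
  note D = has_weak_derivative_of_wderiv[OF w]
  let ?f = "\<lambda>t. (norm (u t))\<^sup>2 + (norm (wderiv u t))\<^sup>2 + (norm (wderiv (wderiv u) t))\<^sup>2"
  let ?B = "a\<^sup>2 + b\<^sup>2 + c\<^sup>2"
  have "AE t in circle. ?f t \<le> ?B"
    using AE_wderiv_eq[OF w(1)] AE_wderiv_eq[OF D]
    by eventually_elim (auto intro!: add_mono power_mono b)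
  then have "(\<integral>t. ?f t \<partial>circle) \<le> (\<integral>t. ?B \<partial>circle)"
    by (intro integral_mono_AE') (auto intro!: integrable_circle_continuous)
  also have "\<dots> = 2 * pi * ?B"
    by (simp add: measure_restrict_space)
  finally show ?thesis unfolding H2_norm_def by (rule real_sqrt_le_mono)
qed

theorem proposition4p1:
  fixes R \<Lambda> :: real and q :: nat
  assumes "0 < R" and "0 < q" and "0 < \<Lambda>"
  shows "\<exists>C>0. \<forall>lam u. (lam, u) \<in> Zreg R \<and> 0 < lam \<and> lam \<le> \<Lambda> \<and> vertical_nodal_number R u q \<longrightarrow>
           W2inf_norm (curve R u) \<le> ereal C \<and> H2_norm u \<le> C"
proof -
  \<comment> \<open>\<open>M\<close> and \<open>A\<close> are the bounds on speed and acceleration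
    with \<open>lam\<close> replaced by \<open>\<Lambda>\<close>. In \<open>B\<close> each bound
    grows by \<open>R\<close>, because \<open>u\<close> is the curve minus \<open>x0 R\<close>, and
    \<open>x0 R\<close> and its first two derivatives have norm \<open>R\<close>.\<close>
  define M where "M = sqrt (4 * \<Lambda> * R + (real q * R)\<^sup>2)"
  define A where "A = (1 / R\<^sup>2) * ((\<Lambda> * R + M\<^sup>2) * R + \<Lambda> * R\<^sup>2 + \<Lambda> * (R * M))"
  define B where "B = sqrt (2 * pi * ((2 * R)\<^sup>2 + (M + R)\<^sup>2 + (A + R)\<^sup>2))"
  have "M \<ge> 0" using assms by (simp add: M_def)
  then have "A \<ge> 0" using assms by (simp add: A_def)
  have "B \<ge> 0" by (simp add: B_def)
  have "W2inf_norm (curve R u) \<le> ereal (R + M + A) \<and> H2_norm u \<le> B"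
    if "(lam, u) \<in> Zreg R" "0 < lam" "lam \<le> \<Lambda>" "vertical_nodal_number R u q" for lam u
  proof -
    let ?x = "curve R u"
    have Z: "(lam, u) \<in> Zset R" using that(1) by (simp add: Zreg_def)
    note lam_pos = that(2)
    obtain X where "sphere_solution R lam ?x X"
      using Zset_classical[OF assms(1) Z] assms(1) lam_pos unfolding sphere_solution_def by metis
    then interpret sphere_solution R lam ?x X .
    have "vertical R u = (\<lambda>t. ?x t $ 3)" by (simp add: vertical_def fun_eq_iff)
    note vert = this and reg = that(1) and nodal = that(4)
    have "\<exists>e1 e2 e3. is_min_value (\<lambda>t. ?x t $ 3) e1 \<and> is_max_value (\<lambda>t. ?x t $ 3) e2 \<and>
        - R < e1 \<and> e1 < e2 \<and> e2 < R \<and> e2 < e3 \<and>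
        (\<forall>s. vertical_poly R lam ?x s = 2 * lam / R\<^sup>2 * (s - e1) * (s - e2) * (s - e3))"
      using reg by (simp only: Zreg_def vert mem_Collect_eq prod.case)
    then obtain e1 e2 e3 where e: "is_min_value (\<lambda>t. ?x t $ 3) e1" "is_max_value (\<lambda>t. ?x t $ 3) e2"
      "- R < e1" "e1 < e2" "e2 < R" "e2 < e3"
      "\<And>s. vertical_poly R lam ?x s = 2 * lam / R\<^sup>2 * (s - e1) * (s - e2) * (s - e3)"
      by blast
    have per: "minimal_period (\<lambda>t. ?x t $ 3) (2 * pi / real q)"
      using nodal unfolding vertical_nodal_number_def vert by blast
    have nX: "norm (X t) \<le> M" for t
    proof -
      have "X t \<bullet> X t \<le> 4 * lam * R + (real q * R)\<^sup>2"
        by (rule speed_bound[OF e(3-7) e(1,2) assms(2) per])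
      also have "\<dots> \<le> 4 * \<Lambda> * R + (real q * R)\<^sup>2"
        using that(3) assms(1) by simp
      finally show ?thesis
        unfolding M_def norm_eq_sqrt_inner by (rule real_sqrt_le_mono)
    qed
    have nA: "norm (accel R lam (?x t) (X t)) \<le> A" for t
      unfolding A_def by (rule accel_bound[OF nX that(3)])
    have "W2inf_norm ?x \<le> ereal (R + M + A)"
      by (rule W2inf_norm_le[OF weak_derivatives]) (simp_all add: norm_x nX nA)
    moreover have "H2_norm u \<le> B"
      unfolding B_def
    proof (rule H2_norm_le)
      have u: "u t = ?x t - x0 R t" for t by (simp add: curve_def)
      show "has_weak_derivative u (\<lambda>t. X t - x0' R t)"
        using has_weak_derivative_diff[OF weak_derivatives(1) x0_weak_derivatives(1), of R]
        by (simp flip: u)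
      show "has_weak_derivative (\<lambda>t. X t - x0' R t) (\<lambda>t. accel R lam (?x t) (X t) - - x0 R t)"
        by (rule has_weak_derivative_diff[OF weak_derivatives(2) x0_weak_derivatives(2)])
      show "norm (u t) \<le> 2 * R" for t
        using norm_triangle_ineq4[of "?x t" "x0 R t"] x0_norm[OF assms(1), of t] norm_x[of t]
        by (simp flip: u)
      show "norm (X t - x0' R t) \<le> M + R" for t
        using norm_triangle_ineq4[of "X t" "x0' R t"] x0_norm[OF assms(1), of t] nX[of t] by simp
      show "norm (accel R lam (?x t) (X t) - - x0 R t) \<le> A + R" for t
        using norm_triangle_ineq4[of "accel R lam (?x t) (X t)" "- x0 R t"] x0_norm[OF assms(1), of t] nA[of t]
        by simp
    qed
    ultimately show ?thesis ..
  qed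
  moreover have "ereal (R + M + A) \<le> ereal (R + M + A + B)" using \<open>B \<ge> 0\<close> by simp
  moreover have "B \<le> R + M + A + B" "R + M + A + B > 0"
    using assms \<open>M \<ge> 0\<close> \<open>A \<ge> 0\<close> \<open>B \<ge> 0\<close> by auto
  ultimately show ?thesis
    \<comment> \<open>The sum of the two nonnegative bounds serves both norms, and \<open>R\<close>
      makes it positive.\<close>
    by (intro exI[of _ "R + M + A + B"]) (meson order_trans)
qed

end
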